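(* Let $\rho$ be a bipartite quantum state on $\mathbb{C}^{d_1}\otimes\mathbb{C}^{d_2}$, $d_1,d_2\ge2$, that does not admit the LHV description for a given setting $S_1\times S_2$. Let $\tau_\rho^{(1)}=\mathrm{tr}_{\mathbb{C}^{d_2}}[\rho]$ and $\tau_\rho^{(2)}=\mathrm{tr}_{\mathbb{C}^{d_1}}[\rho]$ be the reduced states on $\mathbb{C}^{d_1}$ and $\mathbb{C}^{d_2}$, let $\|\cdot\|$ be the operator norm, and put $$\beta_\rho=\min\big\{d_1(S_2-1)\|\tau_\rho^{(1)}\|\,;\ d_2(S_1-1)\|\tau_\rho^{(2)}\|\big\}.$$ Then the noisy state $$\eta_\rho(\gamma)=(1-\gamma)\frac{I_{\mathbb{C}^{d_1}\otimes\mathbb{C}^{d_2}}}{d_1d_2}+\gamma\rho,\qquad 0\le\gamma\le(1+\beta_\rho)^{-1},$$ admits the $S_1\times S_2$-setting LHV description under any generalized EPR local quantum measurements of the two parties.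
   Context: A bipartite quantum state $\rho$ on $\mathbb{C}^{d_1}\otimes\mathbb{C}^{d_2}$ is a density operator (positive, trace one). A generalized quantum measurement on $\mathbb{C}^{d}$ is described by a POV measure: a $\sigma$-additive map $\mathrm{M}$ from the measurable subsets of an outcome set $\Lambda$ (an arbitrary measurable space; outcomes need not be real numbers and may be of any spectral type, discrete or continuous) to positive operators on $\mathbb{C}^d$, with $\mathrm{M}(\Lambda)=I$. An $S_1\times S_2$-setting family of (generalized) EPR local bipartite joint measurements performed on $\rho$ is given by POV measures $\mathrm{M}_n^{(s_n)}$ on $\Lambda_n^{(s_n)}$ with values on $\mathbb{C}^{d_n}$, $s_n=1,\dots,S_n$, $n=1,2$, with joint probability distributions $$P_{(s_1,s_2)}(D_1\times D_2\,|\,\rho)=\mathrm{tr}\big[\rho\{\mathrm{M}_1^{(s_1)}(D_1)\otimes\mathrm{M}_2^{(s_2)}(D_2)\}\big].$$ Such a family (with positive integers $S_1,S_2$, $S_1+S_2>2$) admits an LHV model if there exist a probability space $(\Omega,\mathcal{F}_\Omega,\nu)$ (which may depend on the whole family) and, for each $n$ and $s_n$, a conditional probability distribution $P_n^{(s_n)}(\cdot|\omega)$ on $\Lambda_n^{(s_n)}$, defined for $\nu$-a.e. $\omega$, measurable in $\omega$, depending only on the setting $s_n$ at site $n$, such that for all $(s_1,s_2)$ and measurable $D_1,D_2$, $$P_{(s_1,s_2)}(D_1\times D_2|\rho)=\int_\Omega P_1^{(s_1)}(D_1|\omega)P_2^{(s_2)}(D_2|\omega)\,\nu(d\omega).$$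 The state $\rho$ admits an $S_1\times S_2$-setting LHV description if every $S_1\times S_2$-setting family of EPR local bipartite joint measurements performed on $\rho$ admits an LHV model. *)

theory Defs
  imports "HOL-Probability.Probability"
begin

text \<open>
  Operators on \<open>\<complex>\<^sup>d\<close> are matrices \<^typ>\<open>complex^'m^'m\<close> with \<open>d = CARD('m)\<close>, and
  operators on \<open>\<complex>\<^sup>d\<^sup>1 \<otimes> \<complex>\<^sup>d\<^sup>2\<close> are matrices indexed by the product type \<^typ>\<open>'m \<times> 'n\<close>.
\<close>

definition cinner :: "complex^'m \<Rightarrow> complex^'m \<Rightarrow> complex" where
  "cinner u v = (\<Sum>i\<in>UNIV. cnj (u $ i) * v $ i)"

definition positive_operator :: "complex^'m^'m \<Rightarrow> bool" where
  "positive_operator A \<longleftrightarrow> (\<forall>v. cinner v (A *v v) \<in> \<real> \<and> 0 \<le> Re (cinner v (A *v v)))"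

definition density_operator :: "complex^'m^'m \<Rightarrow> bool" where
  "density_operator \<rho> \<longleftrightarrow> positive_operator \<rho> \<and> trace \<rho> = 1"

definition tensor_op ::
    "complex^'m^'m \<Rightarrow> complex^'n^'n \<Rightarrow> complex^('m::finite \<times> 'n::finite)^('m \<times> 'n)" where
  "tensor_op A B = (\<chi> i j. A $ fst i $ fst j * B $ snd i $ snd j)"

definition reduced_state1 :: "complex^('m::finite \<times> 'n::finite)^('m \<times> 'n) \<Rightarrow> complex^'m^'m" where
  "reduced_state1 \<rho> = (\<chi> i j. \<Sum>k\<in>UNIV. \<rho> $ (i, k) $ (j, k))"

definition reduced_state2 :: "complex^('m::finite \<times> 'n::finite)^('m \<times> 'n) \<Rightarrow> complex^'n^'n" where
  "reduced_state2 \<rho> = (\<chi> i j. \<Sum>k\<in>UNIV. \<rho> $ (k, i) $ (k, j))"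

definition op_norm :: "complex^'m^'m \<Rightarrow> real" where
  "op_norm A = onorm (\<lambda>v. A *v v)"

definition beta :: "nat \<Rightarrow> nat \<Rightarrow> complex^('m::finite \<times> 'n::finite)^('m \<times> 'n) \<Rightarrow> real" where
  "beta S1 S2 \<rho> =
     min (real CARD('m) * (real S2 - 1) * op_norm (reduced_state1 \<rho>))
         (real CARD('n) * (real S1 - 1) * op_norm (reduced_state2 \<rho>))"

definition noisy_state ::
    "complex^('m::finite \<times> 'n::finite)^('m \<times> 'n) \<Rightarrow> real \<Rightarrow> complex^('m::finite \<times> 'n::finite)^('m \<times> 'n)" where
  "noisy_state \<rho> \<gamma> =
     ((1 - \<gamma>) / (real CARD('m) * real CARD('n))) *\<^sub>R mat 1 + \<gamma> *\<^sub>R \<rho>"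

text \<open>
  The outcome set is given by the measurable space \<open>(space \<Lambda>, sets \<Lambda>)\<close>; the measure carried by
  \<open>\<Lambda>\<close> plays no role. The series converges in norm.
\<close>

definition pov_measure :: "'o measure \<Rightarrow> ('o set \<Rightarrow> complex^'m^'m) \<Rightarrow> bool" where
  "pov_measure \<Lambda> M \<longleftrightarrow>
     (\<forall>D\<in>sets \<Lambda>. positive_operator (M D)) \<and>
     M (space \<Lambda>) = mat 1 \<and>
     (\<forall>A :: nat \<Rightarrow> 'o set. range A \<subseteq> sets \<Lambda> \<longrightarrow> disjoint_family A \<longrightarrow>
        (\<lambda>i. M (A i)) sums M (\<Union>i. A i))"

text \<open>
  A conditional distribution only has to be a probability measure on \<open>\<Lambda>\<close> almost everywhere.
  HOL functions being total, \<open>P\<close> also has some value on the exceptional null set. Requiring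
  measurability there as well costs no generality, since \<open>P\<close> can be made constant on a
  measurable null set containing it.
\<close>

definition conditional_distribution ::
    "'w measure \<Rightarrow> 'o measure \<Rightarrow> ('w \<Rightarrow> 'o measure) \<Rightarrow> bool" where
  "conditional_distribution \<nu> \<Lambda> P \<longleftrightarrow>
     (AE \<omega> in \<nu>. prob_space (P \<omega>) \<and> sets (P \<omega>) = sets \<Lambda>) \<and>
     (\<forall>D\<in>sets \<Lambda>. (\<lambda>\<omega>. measure (P \<omega>) D) \<in> borel_measurable \<nu>)"

definition joint_probability ::
    "complex^('m::finite \<times> 'n::finite)^('m \<times> 'n) \<Rightarrow> complex^'m^'m \<Rightarrow> complex^'n^'n \<Rightarrow> complex" where
  "joint_probability \<rho> E F = trace (\<rho> ** tensor_op E F)"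

text \<open>
  The settings at site \<open>n\<close> are the indices \<open>1, \<dots>, S\<^sub>n\<close>. Each setting has its own measurable space
  of outcomes.
\<close>

definition lhv_model ::
    "nat \<Rightarrow> nat \<Rightarrow> complex^('m::finite \<times> 'n::finite)^('m \<times> 'n) \<Rightarrow>
     (nat \<Rightarrow> 'a measure) \<Rightarrow> (nat \<Rightarrow> 'a set \<Rightarrow> complex^'m^'m) \<Rightarrow>
     (nat \<Rightarrow> 'b measure) \<Rightarrow> (nat \<Rightarrow> 'b set \<Rightarrow> complex^'n^'n) \<Rightarrow>
     'w measure \<Rightarrow> (nat \<Rightarrow> 'w \<Rightarrow> 'a measure) \<Rightarrow> (nat \<Rightarrow> 'w \<Rightarrow> 'b measure) \<Rightarrow> bool" where
  "lhv_model S1 S2 \<rho> \<Lambda>1 M1 \<Lambda>2 M2 \<nu> P1 P2 \<longleftrightarrow>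
     prob_space \<nu> \<and>
     (\<forall>s\<in>{1..S1}. conditional_distribution \<nu> (\<Lambda>1 s) (P1 s)) \<and>
     (\<forall>s\<in>{1..S2}. conditional_distribution \<nu> (\<Lambda>2 s) (P2 s)) \<and>
     (\<forall>s1\<in>{1..S1}. \<forall>s2\<in>{1..S2}. \<forall>D1\<in>sets (\<Lambda>1 s1). \<forall>D2\<in>sets (\<Lambda>2 s2).
        joint_probability \<rho> (M1 s1 D1) (M2 s2 D2) =
          complex_of_real (\<integral>\<omega>. measure (P1 s1 \<omega>) D1 * measure (P2 s2 \<omega>) D2 \<partial>\<nu>))"

text \<open>
  The probability space of an LHV model may live on any type, but HOL cannot quantify existentially
  over types. Taking tuples of outcomes, one outcome per setting and site, as the hidden variables
  loses nothing: \<open>admits_lhv_modelI\<close> below turns a model on an arbitrary type \<^typ>\<open>'w\<close> into one of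
  this form.
\<close>

definition admits_lhv_model ::
    "nat \<Rightarrow> nat \<Rightarrow> complex^('m::finite \<times> 'n::finite)^('m \<times> 'n) \<Rightarrow>
     (nat \<Rightarrow> 'a measure) \<Rightarrow> (nat \<Rightarrow> 'a set \<Rightarrow> complex^'m^'m) \<Rightarrow>
     (nat \<Rightarrow> 'b measure) \<Rightarrow> (nat \<Rightarrow> 'b set \<Rightarrow> complex^'n^'n) \<Rightarrow> bool" where
  "admits_lhv_model S1 S2 \<rho> \<Lambda>1 M1 \<Lambda>2 M2 \<longleftrightarrow>
     (\<exists>(\<nu> :: ((nat \<Rightarrow> 'a) \<times> (nat \<Rightarrow> 'b)) measure) P1 P2.
        lhv_model S1 S2 \<rho> \<Lambda>1 M1 \<Lambda>2 M2 \<nu> P1 P2)"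

text \<open>
  The type arguments are the ambient types of the outcome sets at the two sites. ``For all outcome
  spaces'' in the mathematical notion is a quantification over these types: the notion holds if
  the predicate holds at all types, and fails if it fails at some pair of types.
\<close>

definition admits_lhv_description ::
    "'a itself \<Rightarrow> 'b itself \<Rightarrow> nat \<Rightarrow> nat \<Rightarrow> complex^('m::finite \<times> 'n::finite)^('m \<times> 'n) \<Rightarrow> bool" where
  "admits_lhv_description (_ :: 'a itself) (_ :: 'b itself) S1 S2 \<rho> \<longleftrightarrow>
     (\<forall>(\<Lambda>1 :: nat \<Rightarrow> 'a measure) M1 (\<Lambda>2 :: nat \<Rightarrow> 'b measure) M2.
        (\<forall>s\<in>{1..S1}. pov_measure (\<Lambda>1 s) (M1 s)) \<longrightarrow>
        (\<forall>s\<in>{1..S2}. pov_measure (\<Lambda>2 s) (M2 s)) \<longrightarrow>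
        admits_lhv_model S1 S2 \<rho> \<Lambda>1 M1 \<Lambda>2 M2)"

lemma PiM_kernel:
  fixes L :: "nat \<Rightarrow> 'a measure"
  assumes I: "finite I"
    and K: "\<And>i. i \<in> I \<Longrightarrow> K i \<in> \<nu> \<rightarrow>\<^sub>M prob_algebra (L i)"
  shows "(\<lambda>w. PiM I (\<lambda>i. K i w)) \<in> \<nu> \<rightarrow>\<^sub>M prob_algebra (PiM I L)"
proof (rule measurable_prob_algebra_generated[OF sets_PiM Int_stable_prod_algebra prod_algebra_sets_into_space])
  fix w assume w: "w \<in> space \<nu>"
  have Kw: "prob_space (K i w)" "sets (K i w) = sets (L i)" if "i \<in> I" for i
    using measurable_space[OF K[OF that] w] by (auto simp: space_prob_algebra)
  show "prob_space (PiM I (\<lambda>i. K i w))"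
    by (rule prob_space_PiM) (rule Kw)
  show "sets (PiM I (\<lambda>i. K i w)) = sets (PiM I L)"
    by (rule sets_PiM_cong) (auto simp: Kw)
next
  fix A assume "A \<in> prod_algebra I L"
  then obtain X where A: "A = Pi\<^sub>E I X" and X: "\<And>i. i \<in> I \<Longrightarrow> X i \<in> sets (L i)"
    unfolding prod_algebra_eq_finite[OF I] by auto
  have "emeasure (PiM I (\<lambda>i. K i w)) A = (\<Prod>i\<in>I. emeasure (K i w) (X i))"
    if w: "w \<in> space \<nu>" for w
  proof -
    have Kw: "prob_space (K i w)" "sets (K i w) = sets (L i)" if "i \<in> I" for i
      using measurable_space[OF K[OF that] w] by (auto simp: space_prob_algebra)
    define H where "H i = (if i \<in> I then K i w else count_space {undefined})" for i
    interpret H: prob_space "H i" for i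
      using Kw by (cases "i \<in> I") (auto simp: H_def intro!: prob_spaceI)
    interpret product_sigma_finite H
      by unfold_locales
    have "PiM I (\<lambda>i. K i w) = PiM I H"
      by (intro PiM_cong) (auto simp: H_def)
    then show ?thesis
      using emeasure_PiM[of I X] I X Kw by (auto simp: A H_def)
  qed
  moreover have "(\<lambda>w. \<Prod>i\<in>I. emeasure (K i w) (X i)) \<in> borel_measurable \<nu>"
    by (intro borel_measurable_prod_ennreal
        measurable_compose[OF measurable_prob_algebraD[OF K] measurable_emeasure_subprob_algebra] X)
  ultimately show "(\<lambda>w. emeasure (PiM I (\<lambda>i. K i w)) A) \<in> borel_measurable \<nu>"
    by (simp cong: measurable_cong)
qed

lemma PiM_kernel_component:
  assumes I: "finite I" "i \<in> I"
    and K: "\<And>i. i \<in> I \<Longrightarrow> prob_space (K i)"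
    and D: "D \<in> sets (K i)"
  shows "emeasure (PiM I K) {x \<in> space (PiM I K). x i \<in> D} = emeasure (K i) D"
proof -
  define H where "H j = (if j \<in> I then K j else count_space {undefined})" for j
  interpret H: prob_space "H j" for j
    using K by (cases "j \<in> I") (auto simp: H_def intro!: prob_spaceI)
  interpret product_prob_space H I
    by unfold_locales
  have "PiM I K = PiM I H"
    by (intro PiM_cong) (auto simp: H_def)
  then show ?thesis
    using emeasure_PiM_Collect_single[of i D] I D by (simp add: H_def)
qed

lemma conditional_distribution_kernels:
  fixes \<nu> :: "'w measure" and \<Lambda> :: "nat \<Rightarrow> 'a measure"
  assumes \<nu>: "prob_space \<nu>" and I: "finite I"
    and cd: "\<And>s. s \<in> I \<Longrightarrow> conditional_distribution \<nu> (\<Lambda> s) (P s)"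
  obtains K where "\<And>s. s \<in> I \<Longrightarrow> K s \<in> \<nu> \<rightarrow>\<^sub>M prob_algebra (\<Lambda> s)"
    and "AE \<omega> in \<nu>. \<forall>s\<in>I. K s \<omega> = P s \<omega>"
proof -
  interpret prob_space \<nu> by (rule \<nu>)
  have "AE \<omega> in \<nu>. \<forall>s\<in>I. prob_space (P s \<omega>) \<and> sets (P s \<omega>) = sets (\<Lambda> s)"
    using cd I by (intro AE_finite_allI) (auto simp: conditional_distribution_def)
  then obtain N where N: "N \<in> null_sets \<nu>"
    and good: "\<And>\<omega> s. \<omega> \<in> space \<nu> \<Longrightarrow> \<omega> \<notin> N \<Longrightarrow> s \<in> I \<Longrightarrow>
      prob_space (P s \<omega>) \<and> sets (P s \<omega>) = sets (\<Lambda> s)"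
    by (auto elim!: AE_E3)
  have "\<exists>\<omega>\<in>space \<nu>. \<omega> \<notin> N"
    using N emeasure_space_1 by (metis emeasure_mono[of "space \<nu>" N \<nu>] null_setsD1 null_setsD2
        le_zero_eq subsetI zero_neq_one)
  then obtain \<omega>0 where \<omega>0: "\<omega>0 \<in> space \<nu>" "\<omega>0 \<notin> N" by auto
  define g where "g \<omega> = (if \<omega> \<in> N then \<omega>0 else \<omega>)" for \<omega>
  have N': "N \<in> sets \<nu>"
    using N by auto
  have g: "g \<in> \<nu> \<rightarrow>\<^sub>M \<nu>"
    unfolding g_def using N' \<omega>0 by (intro measurable_If_set) (auto simp: sets.Int)
  have gs: "g \<omega> \<in> space \<nu>" "g \<omega> \<notin> N" if "\<omega> \<in> space \<nu>" for \<omega>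
    using that \<omega>0 by (auto simp: g_def)
  show thesis
  proof (rule that[of "\<lambda>s \<omega>. P s (g \<omega>)"])
    fix s assume s: "s \<in> I"
    show "(\<lambda>\<omega>. P s (g \<omega>)) \<in> \<nu> \<rightarrow>\<^sub>M prob_algebra (\<Lambda> s)"
    proof (intro measurable_prob_algebraI measurable_subprob_algebra)
      fix \<omega> assume \<omega>: "\<omega> \<in> space \<nu>"
      show "prob_space (P s (g \<omega>))" "sets (P s (g \<omega>)) = sets (\<Lambda> s)"
        using good[OF gs[OF \<omega>] s] by auto
      then show "subprob_space (P s (g \<omega>))"
        by (auto intro: prob_space_imp_subprob_space)
    next
      fix D assume D: "D \<in> sets (\<Lambda> s)"
      have "(\<lambda>\<omega>. measure (P s (g \<omega>)) D) \<in> borel_measurable \<nu>"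
        using cd[OF s] D by (intro measurable_compose[OF g]) (auto simp: conditional_distribution_def)
      then have "(\<lambda>\<omega>. ennreal (measure (P s (g \<omega>)) D)) \<in> borel_measurable \<nu>"
        by simp
      also have "?this \<longleftrightarrow> (\<lambda>\<omega>. emeasure (P s (g \<omega>)) D) \<in> borel_measurable \<nu>"
      proof (rule measurable_cong)
        fix \<omega> assume "\<omega> \<in> space \<nu>"
        then have "prob_space (P s (g \<omega>))"
          using good[OF gs _, of \<omega>] s by auto
        then interpret Q: prob_space "P s (g \<omega>)" .
        show "ennreal (measure (P s (g \<omega>)) D) = emeasure (P s (g \<omega>)) D"
          by (simp add: Q.emeasure_eq_measure)
      qed
      finally show "(\<lambda>\<omega>. emeasure (P s (g \<omega>)) D) \<in> borel_measurable \<nu>" .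
    qed
  next
    show "AE \<omega> in \<nu>. \<forall>s\<in>I. P s (g \<omega>) = P s \<omega>"
      using AE_not_in[OF N] by eventually_elim (auto simp: g_def)
  qed
qed

lemma return_component_conditional_distribution:
  assumes [measurable]: "f \<in> \<nu> \<rightarrow>\<^sub>M \<Lambda>"
  shows "conditional_distribution \<nu> \<Lambda> (\<lambda>\<omega>. return \<Lambda> (f \<omega>))"
  unfolding conditional_distribution_def
proof (intro conjI ballI)
  show "AE \<omega> in \<nu>. prob_space (return \<Lambda> (f \<omega>)) \<and> sets (return \<Lambda> (f \<omega>)) = sets \<Lambda>"
    using measurable_space[OF assms] by (intro AE_I2) (auto intro: prob_space_return)
  fix D assume [measurable]: "D \<in> sets \<Lambda>"
  have "(\<lambda>\<omega>. indicator D (f \<omega>) :: real) \<in> borel_measurable \<nu>"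
    by measurable
  then show "(\<lambda>\<omega>. measure (return \<Lambda> (f \<omega>)) D) \<in> borel_measurable \<nu>"
    by (simp add: measure_return)
qed

lemma admits_lhv_modelI:
  fixes \<nu> :: "'w measure" and \<rho> :: "complex^('m::finite \<times> 'n::finite)^('m \<times> 'n)"
    and \<Lambda>1 :: "nat \<Rightarrow> 'a measure" and \<Lambda>2 :: "nat \<Rightarrow> 'b measure"
  assumes model: "lhv_model S1 S2 \<rho> \<Lambda>1 M1 \<Lambda>2 M2 \<nu> P1 P2"
  shows "admits_lhv_model S1 S2 \<rho> \<Lambda>1 M1 \<Lambda>2 M2"
proof -
  have \<nu>: "prob_space \<nu>"
    and cd1: "\<And>s. s \<in> {1..S1} \<Longrightarrow> conditional_distribution \<nu> (\<Lambda>1 s) (P1 s)"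
    and cd2: "\<And>s. s \<in> {1..S2} \<Longrightarrow> conditional_distribution \<nu> (\<Lambda>2 s) (P2 s)"
    using model by (auto simp: lhv_model_def)
  interpret prob_space \<nu> by (rule \<nu>)
  obtain K1 where K1: "\<And>s. s \<in> {1..S1} \<Longrightarrow> K1 s \<in> \<nu> \<rightarrow>\<^sub>M prob_algebra (\<Lambda>1 s)"
    and K1_eq: "AE \<omega> in \<nu>. \<forall>s\<in>{1..S1}. K1 s \<omega> = P1 s \<omega>"
    using conditional_distribution_kernels[of \<nu> "{1..S1}" \<Lambda>1 P1] \<nu> cd1 by blast
  obtain K2 where K2: "\<And>s. s \<in> {1..S2} \<Longrightarrow> K2 s \<in> \<nu> \<rightarrow>\<^sub>M prob_algebra (\<Lambda>2 s)"
    and K2_eq: "AE \<omega> in \<nu>. \<forall>s\<in>{1..S2}. K2 s \<omega> = P2 s \<omega>"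
    using conditional_distribution_kernels[of \<nu> "{1..S2}" \<Lambda>2 P2] \<nu> cd2 by blast
  define Q1 where "Q1 \<omega> = PiM {1..S1} (\<lambda>s. K1 s \<omega>)" for \<omega>
  define Q2 where "Q2 \<omega> = PiM {1..S2} (\<lambda>s. K2 s \<omega>)" for \<omega>
  define L where "L = PiM {1..S1} \<Lambda>1 \<Otimes>\<^sub>M PiM {1..S2} \<Lambda>2"
  have Q1: "Q1 \<in> \<nu> \<rightarrow>\<^sub>M prob_algebra (PiM {1..S1} \<Lambda>1)"
    unfolding Q1_def by (rule PiM_kernel) (use K1 in auto)
  have Q2: "Q2 \<in> \<nu> \<rightarrow>\<^sub>M prob_algebra (PiM {1..S2} \<Lambda>2)"
    unfolding Q2_def by (rule PiM_kernel) (use K2 in auto)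
  have Q: "(\<lambda>\<omega>. Q1 \<omega> \<Otimes>\<^sub>M Q2 \<omega>) \<in> \<nu> \<rightarrow>\<^sub>M prob_algebra L"
    unfolding L_def by (rule measurable_pair_prob[OF Q1 Q2])
  have \<nu>_in: "\<nu> \<in> space (prob_algebra \<nu>)"
    using \<nu> by (simp add: space_prob_algebra)
  define \<mu> where "\<mu> = \<nu> \<bind> (\<lambda>\<omega>. Q1 \<omega> \<Otimes>\<^sub>M Q2 \<omega>)"
  have \<mu>: "prob_space \<mu>" and sets_\<mu>: "sets \<mu> = sets L"
    unfolding \<mu>_def using prob_space_bind'[OF \<nu>_in Q] sets_bind'[OF \<nu>_in Q] by auto
  interpret \<mu>: prob_space \<mu> by (rule \<mu>)
  have f1: "(\<lambda>x. fst x s) \<in> \<mu> \<rightarrow>\<^sub>M \<Lambda>1 s" if "s \<in> {1..S1}" for s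
    unfolding measurable_cong_sets[OF sets_\<mu> refl] L_def using that
    by (intro measurable_compose[OF measurable_fst] measurable_component_singleton)
  have f2: "(\<lambda>x. snd x s) \<in> \<mu> \<rightarrow>\<^sub>M \<Lambda>2 s" if "s \<in> {1..S2}" for s
    unfolding measurable_cong_sets[OF sets_\<mu> refl] L_def using that
    by (intro measurable_compose[OF measurable_snd] measurable_component_singleton)
  have "(\<integral>x. measure (return (\<Lambda>1 s1) (fst x s1)) D1 * measure (return (\<Lambda>2 s2) (snd x s2)) D2 \<partial>\<mu>)
      = (\<integral>\<omega>. measure (P1 s1 \<omega>) D1 * measure (P2 s2 \<omega>) D2 \<partial>\<nu>)"
    if s: "s1 \<in> {1..S1}" "s2 \<in> {1..S2}" and D: "D1 \<in> sets (\<Lambda>1 s1)" "D2 \<in> sets (\<Lambda>2 s2)"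
    for s1 s2 D1 D2
  proof -
    define X1 where "X1 = {x \<in> space (PiM {1..S1} \<Lambda>1). x s1 \<in> D1}"
    define X2 where "X2 = {x \<in> space (PiM {1..S2} \<Lambda>2). x s2 \<in> D2}"
    have X1: "X1 \<in> sets (PiM {1..S1} \<Lambda>1)"
      unfolding X1_def using s D by measurable
    have X2: "X2 \<in> sets (PiM {1..S2} \<Lambda>2)"
      unfolding X2_def using s D by measurable
    have X: "X1 \<times> X2 \<in> sets L"
      using X1 X2 by (simp add: L_def)
    have sp: "space \<mu> = space (PiM {1..S1} \<Lambda>1) \<times> space (PiM {1..S2} \<Lambda>2)"
      using sets_eq_imp_space_eq[OF sets_\<mu>] by (simp add: L_def space_pair_measure)
    have "(\<integral>x. measure (return (\<Lambda>1 s1) (fst x s1)) D1 * measure (return (\<Lambda>2 s2) (snd x s2)) D2 \<partial>\<mu>)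
        = (\<integral>x. indicator (X1 \<times> X2) x \<partial>\<mu>)"
      using D by (intro Bochner_Integration.integral_cong)
        (auto simp: measure_return X1_def X2_def sp split: split_indicator)
    also have "\<dots> = measure \<mu> (X1 \<times> X2)"
      using X sets_\<mu> by simp
    also have "\<dots> = enn2real (\<integral>\<^sup>+\<omega>. emeasure (Q1 \<omega> \<Otimes>\<^sub>M Q2 \<omega>) (X1 \<times> X2) \<partial>\<nu>)"
      unfolding \<mu>_def measure_def using emeasure_bind_prob_algebra[OF \<nu>_in Q X] by simp
    also have "(\<integral>\<^sup>+\<omega>. emeasure (Q1 \<omega> \<Otimes>\<^sub>M Q2 \<omega>) (X1 \<times> X2) \<partial>\<nu>)
        = (\<integral>\<^sup>+\<omega>. ennreal (measure (P1 s1 \<omega>) D1 * measure (P2 s2 \<omega>) D2) \<partial>\<nu>)"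
    proof (rule nn_integral_cong_AE)
      show "AE \<omega> in \<nu>. emeasure (Q1 \<omega> \<Otimes>\<^sub>M Q2 \<omega>) (X1 \<times> X2) =
          ennreal (measure (P1 s1 \<omega>) D1 * measure (P2 s2 \<omega>) D2)"
        using K1_eq K2_eq AE_space
      proof eventually_elim
        case (elim \<omega>)
        have k1: "prob_space (K1 s \<omega>)" "sets (K1 s \<omega>) = sets (\<Lambda>1 s)" if "s \<in> {1..S1}" for s
          using measurable_space[OF K1[OF that] elim(3)] by (auto simp: space_prob_algebra)
        have k2: "prob_space (K2 s \<omega>)" "sets (K2 s \<omega>) = sets (\<Lambda>2 s)" if "s \<in> {1..S2}" for s
          using measurable_space[OF K2[OF that] elim(3)] by (auto simp: space_prob_algebra)
        have q1: "prob_space (Q1 \<omega>)" "sets (Q1 \<omega>) = sets (PiM {1..S1} \<Lambda>1)"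
          using measurable_space[OF Q1 elim(3)] by (auto simp: space_prob_algebra)
        have q2: "prob_space (Q2 \<omega>)" "sets (Q2 \<omega>) = sets (PiM {1..S2} \<Lambda>2)"
          using measurable_space[OF Q2 elim(3)] by (auto simp: space_prob_algebra)
        interpret q1: prob_space "Q1 \<omega>" by (rule q1)
        interpret q2: prob_space "Q2 \<omega>" by (rule q2)
        interpret p1: prob_space "K1 s1 \<omega>" by (rule k1[OF s(1)])
        interpret p2: prob_space "K2 s2 \<omega>" by (rule k2[OF s(2)])
        have e1: "emeasure (Q1 \<omega>) X1 = emeasure (K1 s1 \<omega>) D1"
          using PiM_kernel_component[of "{1..S1}" s1 "\<lambda>s. K1 s \<omega>" D1] s D k1
            sets_eq_imp_space_eq[OF q1(2)]
          by (simp add: X1_def Q1_def)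
        have e2: "emeasure (Q2 \<omega>) X2 = emeasure (K2 s2 \<omega>) D2"
          using PiM_kernel_component[of "{1..S2}" s2 "\<lambda>s. K2 s \<omega>" D2] s D k2
            sets_eq_imp_space_eq[OF q2(2)]
          by (simp add: X2_def Q2_def)
        have "emeasure (Q1 \<omega> \<Otimes>\<^sub>M Q2 \<omega>) (X1 \<times> X2) = emeasure (Q1 \<omega>) X1 * emeasure (Q2 \<omega>) X2"
          using X1 X2 q1 q2 by (intro q2.emeasure_pair_measure_Times) auto
        also have "\<dots> = ennreal (measure (K1 s1 \<omega>) D1 * measure (K2 s2 \<omega>) D2)"
          by (simp add: e1 e2 p1.emeasure_eq_measure p2.emeasure_eq_measure ennreal_mult)
        finally show ?case
          using elim s by simp
      qed
    qed
    also have "enn2real \<dots> = (\<integral>\<omega>. measure (P1 s1 \<omega>) D1 * measure (P2 s2 \<omega>) D2 \<partial>\<nu>)"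
    proof (rule integral_eq_nn_integral[symmetric])
      show "(\<lambda>\<omega>. measure (P1 s1 \<omega>) D1 * measure (P2 s2 \<omega>) D2) \<in> borel_measurable \<nu>"
        using cd1[OF s(1)] cd2[OF s(2)] D
        by (intro borel_measurable_times) (auto simp: conditional_distribution_def)
    qed simp
    finally show ?thesis .
  qed
  then have "lhv_model S1 S2 \<rho> \<Lambda>1 M1 \<Lambda>2 M2 \<mu>
      (\<lambda>s x. return (\<Lambda>1 s) (fst x s)) (\<lambda>s x. return (\<Lambda>2 s) (snd x s))"
    using model \<mu> return_component_conditional_distribution[OF f1]
      return_component_conditional_distribution[OF f2]
    by (simp add: lhv_model_def)
  then show ?thesis
    unfolding admits_lhv_model_def by blast
qed

end

theory Submission
  imports Defs
begin

text \<open>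
  By symmetry let the first argument attain the minimum in \<open>\<beta>\<^sub>\<rho>\<close>. On
  \<open>\<complex>\<^sup>d\<^sup>1 \<otimes> (\<complex>\<^sup>d\<^sup>2)\<^sup>\<otimes>\<^sup>S\<^sup>2\<close> consider the operator obtained by summing, over the copies \<open>k\<close> of
  \<open>\<complex>\<^sup>d\<^sup>2\<close>, the state \<open>\<rho>\<close> on the factors \<open>(1, k)\<close> tensored with the maximally mixed state on the others,
  and subtracting \<open>S\<^sub>2 - 1\<close> times \<open>\<tau>\<^sub>\<rho>\<^sup>(\<^sup>1\<^sup>)\<close> tensored with the maximally mixed state. Its reduction to each
  pair \<open>(1, k)\<close> is \<open>\<rho>\<close>, and mixing it with white noise in the ratio \<open>\<gamma> : 1 - \<gamma>\<close> makes it positive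
  because \<open>(1 - \<gamma>) / d\<^sub>1 \<ge> \<gamma> (S\<^sub>2 - 1) \<parallel>\<tau>\<^sub>\<rho>\<^sup>(\<^sup>1\<^sup>)\<parallel>\<close>. Measuring all
  settings of the second party jointly on the copies gives a tuple \<open>b\<close> of outcomes, which serves as
  the hidden variable; the first party's outcome is drawn from its conditional state given \<open>b\<close>.

  Outcome spaces need not be standard Borel, so regular conditional probabilities may fail to exist.
  Instead a POV measure \<open>N\<close> is given a positive operator-valued density with respect to the scalar
  measure \<open>tr N / d\<^sub>2\<close>, and the conditional state \<open>G b\<close> is built from these densities.
\<close>

subsection \<open>Positive operators\<close>

lemma cinner_add_right: "cinner u (v + w) = cinner u v + cinner u w"
  by (simp add: cinner_def algebra_simps sum.distrib)

lemma cinner_add_left: "cinner (u + v) w = cinner u w + cinner v w"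
  by (simp add: cinner_def algebra_simps sum.distrib)

lemma cinner_scale_right: "cinner u (c *s v) = c * cinner u v"
  by (simp add: cinner_def sum_distrib_left algebra_simps)

lemma cinner_scale_left: "cinner (c *s u) v = cnj c * cinner u v"
  by (simp add: cinner_def sum_distrib_left algebra_simps)

lemma cinner_axis_left: "cinner (axis i 1) v = v $ i"
  by (simp add: cinner_def axis_def if_distrib [of "\<lambda>x. x * _"] if_distrib [of cnj] cong: if_cong)

lemma Re_cinner: "Re (cinner u v) = u \<bullet> v"
  by (simp add: cinner_def inner_vec_def inner_complex_def)

lemma cinner_diff_right: "cinner u (v - w) = cinner u v - cinner u w"
  by (simp add: cinner_def algebra_simps sum_subtractf)

lemma mult_axis_component:
  fixes A :: "complex^'m^'n"
  shows "(A *v axis j 1) $ i = A $ i $ j"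
  by (simp add: matrix_vector_mult_def axis_def if_distrib cong: if_cong)

lemma cinner_mult_axis:
  fixes A :: "complex^'m^'m"
  shows "cinner (axis i 1) (A *v axis j 1) = A $ i $ j"
  by (simp add: cinner_axis_left mult_axis_component)

lemma positive_operator_quadratic:
  fixes A :: "complex^'m^'m"
  assumes "positive_operator A"
  shows "cinner v (A *v v) = of_real (Re (cinner v (A *v v)))" "0 \<le> Re (cinner v (A *v v))"
  using assms by (auto simp: positive_operator_def of_real_Re)

text \<open>Polarization: the form is real at \<open>u + c v\<close>. For \<open>c = 1\<close> this
  makes the imaginary parts of the two cross terms opposite, and for \<open>c = \<i>\<close> it
  makes their real parts equal.\<close>

lemma positive_operator_hermitian_form:
  fixes A :: "complex^'m^'m"
  assumes A: "positive_operator A"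
  shows "cinner u (A *v v) = cnj (cinner v (A *v u))"
proof -
  have im: "Im (cinner w (A *v w)) = 0" for w
    using A by (simp add: positive_operator_def complex_is_Real_iff)
  have "cinner (u + c *s v) (A *v (u + c *s v)) =
      cinner u (A *v u) + c * cinner u (A *v v) + cnj c * cinner v (A *v u)
      + cnj c * (c * cinner v (A *v v))" for c
    by (simp add: matrix_vector_right_distrib vector_scalar_commute cinner_add_left
        cinner_add_right cinner_scale_left cinner_scale_right algebra_simps)
  from arg_cong[OF this[of 1], of Im] arg_cong[OF this[of \<i>], of Im]
  show ?thesis
    by (simp add: im complex_eq_iff)
qed

lemma positive_operator_hermitian:
  fixes A :: "complex^'m^'m"
  assumes "positive_operator A"
  shows "A $ i $ j = cnj (A $ j $ i)"
  using positive_operator_hermitian_form[OF assms, of "axis i 1" "axis j 1"]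
  by (simp add: cinner_mult_axis)

lemma positive_operator_diag:
  fixes A :: "complex^'m^'m"
  assumes "positive_operator A"
  shows "A $ i $ i = of_real (Re (A $ i $ i))" "0 \<le> Re (A $ i $ i)"
  using positive_operator_quadratic[OF assms, of "axis i 1"] by (simp_all add: cinner_mult_axis)

text \<open>The rank-one operator written |u><u| in Dirac notation.\<close>

definition outer :: "complex^'m \<Rightarrow> complex^'m^'m" where
  "outer u = (\<chi> i j. u $ i * cnj (u $ j))"

lemma outer_mult: "outer u *v w = cinner u w *s u"
  by (simp add: vec_eq_iff cinner_def outer_def matrix_vector_mult_def sum_distrib_left
      sum_distrib_right algebra_simps)

lemma cinner_outer: "cinner v (outer u *v w) = cinner v u * cinner u w"
  by (simp add: outer_mult cinner_scale_right)

text \<open>Completing the square: the form of \<open>A - outer u\<close> at \<open>v\<close> is that of \<open>A\<close> at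
  \<open>v - ((A v)\<^sub>i / A\<^sub>i\<^sub>i) e\<^sub>i\<close>.\<close>

lemma positive_operator_deflate:
  fixes A :: "complex^'m^'m"
  assumes A: "positive_operator A" and i: "A $ i $ i \<noteq> 0"
  defines "u \<equiv> complex_of_real (1 / sqrt (Re (A $ i $ i))) *s (A *v axis i 1)"
  shows "positive_operator (A - outer u)" and "(A - outer u) $ i $ i = 0"
proof -
  define a where "a = Re (A $ i $ i)"
  have a: "A $ i $ i = of_real a" "a > 0"
    using positive_operator_diag[OF A, of i] i unfolding a_def
    by (auto simp: complex_eq_iff)
  have "sqrt a * sqrt a = a" using a by simp
  then have sq: "complex_of_real (1 / sqrt a) * complex_of_real (1 / sqrt a) = 1 / complex_of_real a"
    by (metis (no_types, lifting) mult_1 of_real_1 of_real_divide of_real_mult times_divide_times_eq)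
  have u: "u = complex_of_real (1 / sqrt a) *s (A *v axis i 1)"
    by (simp add: u_def a_def)
  have ortho: "cinner v ((A - outer u) *v v) =
      cinner w (A *v w)" if "w = v + (- (A *v v) $ i / of_real a) *s axis i 1" for v w
  proof -
    define z where "z = (A *v v) $ i"
    have z: "cinner v (A *v axis i 1) = cnj z"
      using positive_operator_hermitian_form[OF A, of v "axis i 1"]
      by (simp add: cinner_axis_left z_def)
    have z': "cinner (A *v axis i 1) v = z"
      using arg_cong[OF z, of cnj] by (simp add: cinner_def mult.commute)
    have "cinner v ((A - outer u) *v v) = cinner v (A *v v) - cinner v u * cinner u v"
      by (simp add: cinner_outer matrix_vector_mult_diff_rdistrib cinner_diff_right)
    also have "cinner v u * cinner u v =
        (complex_of_real (1 / sqrt a) * complex_of_real (1 / sqrt a)) * (cnj z * z)"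
      by (simp add: u cinner_scale_left cinner_scale_right z z')
    also have "\<dots> = cnj z * z / of_real a"
      unfolding sq by simp
    also have "cinner v (A *v v) - cnj z * z / of_real a = cinner w (A *v w)"
    proof -
      define c where "c = - z / complex_of_real a"
      have w: "w = v + c *s axis i 1"
        by (simp add: that c_def z_def)
      have "cinner w (A *v w) = cinner v (A *v v) + c * cnj z + cnj c * z + cnj c * (c * of_real a)"
        by (simp add: w matrix_vector_right_distrib vector_scalar_commute cinner_add_left
            cinner_add_right cinner_scale_left cinner_scale_right cinner_mult_axis z
            cinner_axis_left[of _ "A *v v"] z_def[symmetric] a algebra_simps)
      moreover have "c * of_real a = - z"
        using a by (simp add: c_def)
      ultimately show ?thesis
        by (simp add: c_def)
    qed
    finally show ?thesis .
  qed
  show "positive_operator (A - outer u)"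
    using A unfolding positive_operator_def by (simp add: ortho)
  have "(A - outer u) $ i $ i = of_real a -
      (complex_of_real (1 / sqrt a) * complex_of_real (1 / sqrt a)) * (of_real a * of_real a)"
    by (simp add: outer_def u mult_axis_component a)
  then show "(A - outer u) $ i $ i = 0"
    unfolding sq using a by simp
qed

text \<open>With zero diagonal, the form at \<open>e_i + c e_j\<close> for
  \<open>c = - cnj A_ij\<close> is minus twice the squared modulus of \<open>A_ij\<close>, so
  positivity leaves only \<open>A_ij = 0\<close>.\<close>

lemma positive_operator_eq_0:
  fixes A :: "complex^'m^'m"
  assumes A: "positive_operator A" and d: "\<And>i. A $ i $ i = 0"
  shows "A = 0"
proof -
  have "A $ i $ j = 0" for i j
  proof -
    define c where "c = - cnj (A $ i $ j)"
    define v :: "complex^'m" where "v = axis i 1 + c *s axis j 1"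
    have "cinner v (A *v v) = c * A $ i $ j + cnj c * A $ j $ i"
      by (simp add: v_def matrix_vector_right_distrib vector_scalar_commute cinner_add_left
          cinner_add_right cinner_scale_left cinner_scale_right cinner_mult_axis d)
    also have "\<dots> = - 2 * of_real ((norm (A $ i $ j))\<^sup>2)"
      unfolding c_def positive_operator_hermitian[OF A, of j i] complex_norm_square by simp
    finally show ?thesis
      using positive_operator_quadratic(2)[OF A, of v] by simp
  qed
  then show ?thesis by (simp add: vec_eq_iff)
qed

text \<open>Takes the place of the spectral theorem: repeated deflation subtracts rank-one
  operators, and each round strictly lowers the number of nonzero diagonal entries.\<close>

lemma positive_operator_decomposition:
  fixes A :: "complex^'m^'m"
  assumes "positive_operator A"
  obtains us where "A = (\<Sum>u\<leftarrow>us. outer u)"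
proof -
  have "\<exists>us. A = (\<Sum>u\<leftarrow>us. outer u)"
    using assms
  proof (induction "card {i. A $ i $ i \<noteq> 0}" arbitrary: A rule: less_induct)
    case less
    show ?case
    proof (cases "\<exists>i. A $ i $ i \<noteq> 0")
      case False
      then have "A = 0" using positive_operator_eq_0[OF less.prems] by auto
      then show ?thesis by (intro exI[of _ "[]"]) simp
    next
      case True
      then obtain i where i: "A $ i $ i \<noteq> 0" by auto
      obtain u where pos: "positive_operator (A - outer u)" and z: "(A - outer u) $ i $ i = 0"
        using positive_operator_deflate[OF less.prems i] by blast
      \<comment> \<open>A zero diagonal entry stays zero: it becomes minus the squared modulus of
        \<open>u_j\<close>, and the remainder is still positive.\<close>
      have "(A - outer u) $ j $ j = 0" if "A $ j $ j = 0" for j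
      proof -
        have "(A - outer u) $ j $ j = - of_real ((norm (u $ j))\<^sup>2)"
          using that unfolding complex_norm_square by (simp add: outer_def)
        then show ?thesis
          using positive_operator_diag[OF pos, of j] by (simp add: complex_eq_iff)
      qed
      then have "{j. (A - outer u) $ j $ j \<noteq> 0} \<subset> {j. A $ j $ j \<noteq> 0}"
        using i z by auto
      then have "card {j. (A - outer u) $ j $ j \<noteq> 0} < card {j. A $ j $ j \<noteq> 0}"
        by (intro psubset_card_mono) auto
      from less.hyps[OF this pos] obtain us where "A - outer u = (\<Sum>u\<leftarrow>us. outer u)" by auto
      then have "A = (\<Sum>u\<leftarrow>u # us. outer u)"
        by (simp add: algebra_simps)
      then show ?thesis by blast
    qed
  qed
  with that show thesis by blast
qed

section \<open>Traces of products, the cone of positive operators, bounds by the trace\<close>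

lemma matrix_mult_add_left: "(A + B) ** C = A ** C + B ** C"
  for A B :: "'a::semiring_1^'n^'m"
  by (simp add: matrix_matrix_mult_def vec_eq_iff algebra_simps sum.distrib)

lemma trace_outer_mult: "trace (outer u ** B) = cinner u (B *v u)"
proof -
  have "trace (outer u ** B) = (\<Sum>i\<in>UNIV. \<Sum>k\<in>UNIV. u $ i * cnj (u $ k) * B $ k $ i)"
    by (simp add: trace_def matrix_matrix_mult_def outer_def)
  also have "\<dots> = (\<Sum>k\<in>UNIV. \<Sum>i\<in>UNIV. u $ i * cnj (u $ k) * B $ k $ i)"
    by (rule sum.swap)
  also have "\<dots> = cinner u (B *v u)"
    by (simp add: cinner_def matrix_vector_mult_def sum_distrib_left algebra_simps)
  finally show ?thesis .
qed

text \<open>Decomposing \<open>A\<close> into rank-one operators turns the trace into a sum of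
  values \<open>cinner u (B *v u)\<close> of the form of \<open>B\<close>.\<close>

lemma trace_mult_nonneg:
  fixes A B :: "complex^'m^'m"
  assumes A: "positive_operator A" and B: "positive_operator B"
  shows "trace (A ** B) \<in> \<real>" and "0 \<le> Re (trace (A ** B))"
proof -
  obtain us where A: "A = (\<Sum>u\<leftarrow>us. outer u)"
    using A by (rule positive_operator_decomposition)
  have "trace (A ** B) \<in> \<real> \<and> 0 \<le> Re (trace (A ** B))"
    unfolding A
  proof (induction us)
    case (Cons u us)
    then show ?case
      using B by (simp add: matrix_mult_add_left trace_add trace_outer_mult positive_operator_def)
  qed (simp add: trace_def)
  then show "trace (A ** B) \<in> \<real>" and "0 \<le> Re (trace (A ** B))" by auto
qed

lemma scaleR_matrix_vector_mult: "(c *\<^sub>R A) *v v = complex_of_real c *s (A *v v)"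
  for A :: "complex^'n^'m"
  by (simp add: vec_eq_iff matrix_vector_mult_def sum_distrib_left scaleR_conv_of_real[where 'a=complex]
      mult.assoc)

lemma positive_operator_scaleR:
  fixes A :: "complex^'m^'m"
  assumes "positive_operator A" "0 \<le> c"
  shows "positive_operator (c *\<^sub>R A)"
  using assms by (simp add: positive_operator_def scaleR_matrix_vector_mult cinner_scale_right)

lemma positive_operator_add:
  fixes A B :: "complex^'m^'m"
  assumes "positive_operator A" "positive_operator B"
  shows "positive_operator (A + B)"
  using assms
  by (simp add: positive_operator_def matrix_vector_mult_add_rdistrib cinner_add_right)

lemma positive_operator_0: "positive_operator (0 :: complex^'m^'m)"
  by (simp add: positive_operator_def cinner_def)

lemma positive_operator_sum:
  fixes f :: "'i \<Rightarrow> complex^'m^'m"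
  assumes "\<And>i. i \<in> I \<Longrightarrow> positive_operator (f i)"
  shows "positive_operator (\<Sum>i\<in>I. f i)"
  using assms
  by (induction I rule: infinite_finite_induct)
    (auto simp: positive_operator_0 intro: positive_operator_add)

lemma positive_operator_mat_1: "positive_operator (mat 1 :: complex^'m^'m)"
proof -
  have "cnj z * z = of_real ((norm z)\<^sup>2)" for z
    by (metis complex_norm_square mult.commute)
  then show ?thesis
    by (auto simp: positive_operator_def cinner_def intro!: sum_nonneg)
qed

text \<open>Arithmetic-geometric mean inequality for the moduli of \<open>u_i\<close> and
  \<open>u_j\<close>, whose squares are each at most the trace.\<close>

lemma norm_outer_component: "norm (outer u $ i $ j) \<le> Re (trace (outer u))"
proof -
  have tr: "Re (trace (outer u)) = (\<Sum>k\<in>UNIV. (norm (u $ k))\<^sup>2)"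
    by (simp add: trace_def outer_def complex_norm_square[symmetric] del: of_real_power)
  have le: "(norm (u $ k))\<^sup>2 \<le> Re (trace (outer u))" for k
    unfolding tr by (rule member_le_sum) auto
  have "norm (outer u $ i $ j) = norm (u $ i) * norm (u $ j)"
    by (simp add: outer_def norm_mult)
  also have "2 * \<dots> \<le> (norm (u $ i))\<^sup>2 + (norm (u $ j))\<^sup>2"
    using sum_squares_bound[of "norm (u $ i)" "norm (u $ j)"] by simp
  also have "\<dots> \<le> 2 * Re (trace (outer u))"
    using le[of i] le[of j] by simp
  finally show ?thesis by simp
qed

lemma norm_positive_operator_component:
  fixes A :: "complex^'m^'m"
  assumes "positive_operator A"
  shows "norm (A $ i $ j) \<le> Re (trace A)"
proof -
  obtain us where A: "A = (\<Sum>u\<leftarrow>us. outer u)"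
    using assms by (rule positive_operator_decomposition)
  show ?thesis
    unfolding A
  proof (induction us)
    case (Cons u us)
    then show ?case
      using norm_outer_component[of u i j]
      by (simp add: trace_add) (smt (verit) norm_triangle_ineq)
  qed (simp add: trace_def)
qed

text \<open>Makes a POV measure dominated by its trace. The factor counts the entries; any constant
  depending only on the dimension would serve.\<close>

lemma norm_positive_operator:
  fixes A :: "complex^'m^'m"
  assumes "positive_operator A"
  shows "norm A \<le> (real CARD('m))\<^sup>2 * Re (trace A)"
proof -
  have l1: "norm x \<le> (\<Sum>i\<in>UNIV. norm (x $ i))" for x :: "'z::real_normed_vector^'m"
    unfolding norm_vec_def by (rule L2_set_le_sum) auto
  have "norm A \<le> (\<Sum>i\<in>UNIV. \<Sum>j\<in>UNIV. norm (A $ i $ j))"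
    by (rule order_trans[OF l1]) (intro sum_mono l1)
  also have "\<dots> \<le> (\<Sum>i\<in>(UNIV::'m set). \<Sum>j\<in>(UNIV::'m set). Re (trace A))"
    by (intro sum_mono norm_positive_operator_component assms)
  finally show ?thesis by (simp add: power2_eq_square)
qed

subsection \<open>Densities of POV measures\<close>

text \<open>Taking the real part gives a pairing that is real-linear in each argument, ready for
  real integration. On positive operators nothing is lost, since the trace is real there.\<close>

definition tr_prod :: "complex^'m^'m \<Rightarrow> complex^'m^'m \<Rightarrow> real" where
  "tr_prod A B = Re (trace (A ** B))"

lemma tr_prod_sum: "tr_prod A B = (\<Sum>i\<in>UNIV. \<Sum>k\<in>UNIV. Re (A $ i $ k * B $ k $ i))"
  by (simp add: tr_prod_def trace_def matrix_matrix_mult_def)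

lemma linear_tr_prod_left: "linear (\<lambda>A. tr_prod A B)"
  by (rule linearI)
    (simp_all add: tr_prod_sum algebra_simps sum.distrib sum_distrib_left sum_subtractf)

lemma linear_tr_prod_right: "linear (tr_prod A)"
  by (rule linearI)
    (simp_all add: tr_prod_sum algebra_simps sum.distrib sum_distrib_left sum_subtractf)

lemmas tr_prod_add_left = linear_add[OF linear_tr_prod_left]
  and tr_prod_diff_left = linear_diff[OF linear_tr_prod_left]
  and tr_prod_sum_left = linear_sum[OF linear_tr_prod_left]
  and tr_prod_scaleR_left = linear_cmul[OF linear_tr_prod_left, unfolded real_scaleR_def]
  and tr_prod_0_right = linear_0[OF linear_tr_prod_right]

lemma bounded_linear_tr_prod_right: "bounded_linear (tr_prod A)"
  using linear_tr_prod_right linear_conv_bounded_linear by blast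

lemma tr_prod_nonneg: "positive_operator A \<Longrightarrow> positive_operator B \<Longrightarrow> 0 \<le> tr_prod A B"
  unfolding tr_prod_def by (rule trace_mult_nonneg)

lemma tr_prod_mat_1: "tr_prod A (mat 1) = Re (trace A)" "tr_prod (mat 1) A = Re (trace A)"
  by (simp_all add: tr_prod_def)

text \<open>The Born rule: how the outcomes of \<open>M\<close> are distributed in the state
  \<open>X\<close>.\<close>

definition outcome_measure ::
    "'o measure \<Rightarrow> ('o set \<Rightarrow> complex^'m^'m) \<Rightarrow> complex^'m^'m \<Rightarrow> 'o measure" where
  "outcome_measure \<Lambda> M X = measure_of (space \<Lambda>) (sets \<Lambda>) (\<lambda>D. ennreal (tr_prod X (M D)))"

lemma sets_outcome_measure [simp, measurable_cong]: "sets (outcome_measure \<Lambda> M X) = sets \<Lambda>"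
  and space_outcome_measure [simp]: "space (outcome_measure \<Lambda> M X) = space \<Lambda>"
  by (simp_all add: outcome_measure_def)

text \<open>Additivity over copies of the empty set gives a convergent series with constant
  terms.\<close>

lemma pov_measure_empty:
  assumes "pov_measure \<Lambda> M"
  shows "M {} = 0"
proof -
  have "(\<lambda>i::nat. M {}) sums M (\<Union>i::nat. {})"
    using assms unfolding pov_measure_def
    by (elim conjE allE[where x = "\<lambda>_. {}"]) (auto simp: disjoint_family_on_def)
  then have "(\<lambda>_::nat. M {}) \<longlonglongrightarrow> 0"
    using summable_LIMSEQ_zero sums_summable by blast
  then show ?thesis
    by (simp add: LIMSEQ_const_iff)
qed

lemma emeasure_outcome_measure:
  assumes M: "pov_measure \<Lambda> M" and X: "positive_operator X" and D: "D \<in> sets \<Lambda>"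
  shows "emeasure (outcome_measure \<Lambda> M X) D = ennreal (tr_prod X (M D))"
  unfolding outcome_measure_def
proof (rule emeasure_measure_of_sigma)
  show "positive (sets \<Lambda>) (\<lambda>D. ennreal (tr_prod X (M D)))"
    by (simp add: positive_def pov_measure_empty[OF M] tr_prod_0_right)
  show "countably_additive (sets \<Lambda>) (\<lambda>D. ennreal (tr_prod X (M D)))"
    unfolding countably_additive_def
  proof safe
    fix A :: "nat \<Rightarrow> 'a set" assume A: "range A \<subseteq> sets \<Lambda>" "disjoint_family A"
    then have "(\<lambda>i. M (A i)) sums M (\<Union>i. A i)"
      using M by (simp add: pov_measure_def)
    then have "(\<lambda>i. tr_prod X (M (A i))) sums tr_prod X (M (\<Union>i. A i))"
      by (rule bounded_linear.sums[OF bounded_linear_tr_prod_right])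
    moreover have "0 \<le> tr_prod X (M (A i))" for i
      using M X A by (intro tr_prod_nonneg) (auto simp: pov_measure_def)
    ultimately show "(\<Sum>i. ennreal (tr_prod X (M (A i)))) = ennreal (tr_prod X (M (\<Union>i. A i)))"
      by (intro suminf_ennreal_eq)
  qed
qed (use D sets.sigma_algebra_axioms in auto)

lemma measure_outcome_measure:
  assumes "pov_measure \<Lambda> M" "positive_operator X" "D \<in> sets \<Lambda>"
  shows "measure (outcome_measure \<Lambda> M X) D = tr_prod X (M D)"
proof -
  have "0 \<le> tr_prod X (M D)"
    using assms by (intro tr_prod_nonneg) (auto simp: pov_measure_def)
  then show ?thesis
    by (simp add: measure_def emeasure_outcome_measure[OF assms])
qed

lemma prob_space_outcome_measure:
  assumes "pov_measure \<Lambda> M" "positive_operator X" "Re (trace X) = 1"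
  shows "prob_space (outcome_measure \<Lambda> M X)"
  using assms emeasure_outcome_measure[OF assms(1,2), of "space \<Lambda>"]
  by (intro prob_spaceI) (simp add: pov_measure_def tr_prod_mat_1)

text \<open>Domination yields both absolute continuity and finiteness of \<open>m\<close>, so
  Radon-Nikodym applies; finiteness then allows a real-valued density.\<close>

lemma (in finite_measure) dominated_measure_density:
  assumes m: "sets m = sets M" and le: "\<And>D. D \<in> sets M \<Longrightarrow> emeasure m D \<le> ennreal c * emeasure M D"
  obtains f :: "'a \<Rightarrow> real" where "integrable M f"
    and "\<And>D. D \<in> sets M \<Longrightarrow> (\<integral>x. indicator D x *\<^sub>R f x \<partial>M) = measure m D"
proof -
  have "absolutely_continuous M m"
    unfolding absolutely_continuous_def
  proof
    fix N assume "N \<in> null_sets M"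
    then show "N \<in> null_sets m"
      using le[of N] m by (auto simp: null_sets_def)
  qed
  moreover have fin: "finite_measure m"
  proof
    have "emeasure m (space m) \<le> ennreal c * emeasure M (space M)"
      using le[of "space M"] sets_eq_imp_space_eq[OF m] by simp
    also have "\<dots> < \<infinity>"
      by (simp add: ennreal_mult_less_top emeasure_eq_measure)
    finally show "emeasure m (space m) \<noteq> \<infinity>" by simp
  qed
  ultimately obtain f where f[measurable]: "f \<in> borel_measurable M" and dens: "density M f = m"
    using Radon_Nikodym_finite_measure[of m] m by blast
  interpret m: finite_measure m by (rule fin)
  have nn: "(\<integral>\<^sup>+x. f x * indicator D x \<partial>M) = ennreal (measure m D)" if "D \<in> sets M" for D
    using that emeasure_density[of f M D] by (simp add: dens m.emeasure_eq_measure)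
  have "(\<integral>\<^sup>+x. f x \<partial>M) = ennreal (measure m (space M))"
    using nn[of "space M"] by (simp cong: nn_integral_cong)
  \<comment> \<open>Since \<open>f\<close> has finite integral, passing to \<open>enn2real\<close>
    changes it only on a null set.\<close>
  then have "AE x in M. f x \<noteq> \<infinity>"
    by (intro nn_integral_PInf_AE) auto
  then have ae: "AE x in M. ennreal (enn2real (f x)) = f x"
    by eventually_elim (simp add: less_top)
  have hi: "has_bochner_integral M (\<lambda>x. indicator D x *\<^sub>R enn2real (f x)) (measure m D)"
    if D[measurable]: "D \<in> sets M" for D
  proof (rule has_bochner_integral_nn_integral)
    have "(\<integral>\<^sup>+x. ennreal (indicator D x *\<^sub>R enn2real (f x)) \<partial>M) = (\<integral>\<^sup>+x. f x * indicator D x \<partial>M)"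
      using ae by (intro nn_integral_cong_AE) (auto elim!: eventually_mono split: split_indicator)
    then show "(\<integral>\<^sup>+x. ennreal (indicator D x *\<^sub>R enn2real (f x)) \<partial>M) = ennreal (measure m D)"
      by (simp add: nn D)
  qed auto
  show thesis
  proof (rule that)
    show "integrable M (\<lambda>x. enn2real (f x))"
      using hi[of "space M"] by (simp add: has_bochner_integral_iff cong: Bochner_Integration.integrable_cong)
    show "(\<integral>x. indicator D x *\<^sub>R enn2real (f x) \<partial>M) = measure m D" if "D \<in> sets M" for D
      using hi[OF that] by (simp add: has_bochner_integral_iff)
  qed
qed

text \<open>Shifting a coordinate of \<open>V\<close> by \<open>c\<close> times the dominating measure makes it nonnegative, so that
  the Radon--Nikodym theorem for positive measures applies.\<close>

lemma (in finite_measure) vector_measure_density: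
  fixes V :: "'a set \<Rightarrow> 'v::euclidean_space"
  assumes add: "\<And>A :: nat \<Rightarrow> 'a set. range A \<subseteq> sets M \<Longrightarrow> disjoint_family A \<Longrightarrow>
      (\<lambda>i. V (A i)) sums V (\<Union>i. A i)"
    and dom: "\<And>D. D \<in> sets M \<Longrightarrow> norm (V D) \<le> c * measure M D"
  obtains f where "integrable M f"
    and "\<And>D. D \<in> sets M \<Longrightarrow> (\<integral>x. indicator D x *\<^sub>R f x \<partial>M) = V D"
proof -
  have "\<exists>f. integrable M f \<and> (\<forall>D\<in>sets M. (\<integral>x. indicator D x *\<^sub>R f x \<partial>M) = V D \<bullet> b)"
    if b: "b \<in> Basis" for b
  proof -
    define h where "h D = V D \<bullet> b + c * measure M D" for D
    have abs_le: "\<bar>V D \<bullet> b\<bar> \<le> c * measure M D" if "D \<in> sets M" for D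
      using dom[OF that] Basis_le_norm[OF b, of "V D"] by simp
    then have h0: "0 \<le> h D" and h2: "h D \<le> 2 * c * measure M D" if "D \<in> sets M" for D
      using abs_le[OF that] by (simp_all add: h_def)
    define m where "m = measure_of (space M) (sets M) (\<lambda>D. ennreal (h D))"
    have em: "emeasure m D = ennreal (h D)" if "D \<in> sets M" for D
      unfolding m_def
    proof (rule emeasure_measure_of_sigma)
      have "norm (V {}) = 0" using dom[of "{}"] by simp
      then show "positive (sets M) (\<lambda>D. ennreal (h D))"
        by (simp add: positive_def h_def)
      show "countably_additive (sets M) (\<lambda>D. ennreal (h D))"
        unfolding countably_additive_def
      proof safe
        fix A :: "nat \<Rightarrow> 'a set" assume A: "range A \<subseteq> sets M" "disjoint_family A"
        have "(\<lambda>i. h (A i)) sums h (\<Union>i. A i)"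
          unfolding h_def
          by (intro sums_add sums_mult bounded_linear.sums[OF bounded_linear_inner_left]
              add A finite_measure_UNION)
        then show "(\<Sum>i. ennreal (h (A i))) = ennreal (h (\<Union>i. A i))"
          using A h0 by (intro suminf_ennreal_eq) auto
      qed
    qed (use that sets.sigma_algebra_axioms in auto)
    have m: "sets m = sets M" by (simp add: m_def)
    have "emeasure m D \<le> ennreal (2 * c) * emeasure M D" if "D \<in> sets M" for D
      using that em h2[OF that] by (simp add: emeasure_eq_measure ennreal_mult''[symmetric] ennreal_leI)
    then obtain f where f: "integrable M f"
      and fD: "\<And>D. D \<in> sets M \<Longrightarrow> (\<integral>x. indicator D x *\<^sub>R f x \<partial>M) = measure m D"
      using dominated_measure_density[OF m] by blast
    \<comment> \<open>The shift is undone by subtracting \<open>c\<close>, the density of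
      \<open>c\<close> times the dominating measure.\<close>
    show ?thesis
    proof (intro exI[of _ "\<lambda>x. f x - c"] conjI ballI)
      show "integrable M (\<lambda>x. f x - c)" using f by simp
      fix D assume D[measurable]: "D \<in> sets M"
      have "(\<integral>x. indicator D x *\<^sub>R (f x - c) \<partial>M) =
          (\<integral>x. indicator D x *\<^sub>R f x \<partial>M) - (\<integral>x. c * indicator D x \<partial>M)"
        using integrable_mult_indicator[OF D f] by (subst Bochner_Integration.integral_diff[symmetric])
          (auto simp: algebra_simps less_top[symmetric])
      also have "\<dots> = V D \<bullet> b"
        using fD[OF D] em[OF D] h0[OF D] by (simp add: measure_def h_def)
      finally show "(\<integral>x. indicator D x *\<^sub>R (f x - c) \<partial>M) = V D \<bullet> b" .
    qed
  qed
  then obtain f where f: "\<And>b. b \<in> Basis \<Longrightarrow> integrable M (f b)"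
    and fD: "\<And>b D. b \<in> Basis \<Longrightarrow> D \<in> sets M \<Longrightarrow> (\<integral>x. indicator D x *\<^sub>R f b x \<partial>M) = V D \<bullet> b"
    by metis
  show thesis
  proof (rule that)
    show "integrable M (\<lambda>x. \<Sum>b\<in>Basis. f b x *\<^sub>R b)"
      using f by (intro Bochner_Integration.integrable_sum integrable_scaleR_left)
    fix D assume D: "D \<in> sets M"
    have "(\<integral>x. indicator D x *\<^sub>R (\<Sum>b\<in>Basis. f b x *\<^sub>R b) \<partial>M)
        = (\<integral>x. (\<Sum>b\<in>Basis. (indicator D x *\<^sub>R f b x) *\<^sub>R b) \<partial>M)"
      by (simp add: scaleR_sum_right)
    also have "\<dots> = (\<Sum>b\<in>Basis. (\<integral>x. indicator D x *\<^sub>R f b x \<partial>M) *\<^sub>R b)"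
      using integrable_mult_indicator[OF D f] by (subst Bochner_Integration.integral_sum)
        (auto intro!: integrable_scaleR_left sum.cong integral_scaleR_left simp del: real_scaleR_def)
    also have "\<dots> = V D"
      using fD[OF _ D] by (simp add: euclidean_representation cong: sum.cong)
    finally show "(\<integral>x. indicator D x *\<^sub>R (\<Sum>b\<in>Basis. f b x *\<^sub>R b) \<partial>M) = V D" .
  qed
qed

text \<open>Test the hypothesis on the set where \<open>h\<close> is negative: the integral over it
  is both nonnegative and nonpositive, so the set is null.\<close>

lemma AE_nonneg_of_set_integrals:
  fixes h :: "'a \<Rightarrow> real"
  assumes h: "integrable M h" and D: "\<And>D. D \<in> sets M \<Longrightarrow> 0 \<le> (\<integral>x. indicator D x *\<^sub>R h x \<partial>M)"
  shows "AE x in M. 0 \<le> h x"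
proof -
  have [measurable]: "h \<in> borel_measurable M" using h by simp
  define N where "N = {x \<in> space M. h x < 0}"
  have N: "N \<in> sets M" unfolding N_def by measurable
  have int: "integrable M (\<lambda>x. - (indicator N x *\<^sub>R h x))"
    using integrable_mult_indicator[OF N h] by simp
  have nn: "AE x in M. 0 \<le> - (indicator N x *\<^sub>R h x)"
    by (intro AE_I2) (auto simp: N_def split: split_indicator)
  have "(\<integral>x. - (indicator N x *\<^sub>R h x) \<partial>M) = 0"
    using D[OF N] integral_nonneg_AE[OF nn] by simp
  then have "AE x in M. - (indicator N x *\<^sub>R h x) = 0"
    using integral_nonneg_eq_0_iff_AE[OF int nn] by blast
  then show ?thesis
    using AE_space by eventually_elim (auto simp: N_def split: split_indicator_asm)
qed

text \<open>Linearity in the operator lets the form commute with integration, which is how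
  positivity passes from a POV measure to its density.\<close>

lemma linear_quadratic_form:
  "linear (\<lambda>A. Re (cinner v (A *v v)))" "linear (\<lambda>A. Im (cinner v (A *v v)))"
  by (auto intro!: linearI
      simp: cinner_def matrix_vector_mult_def algebra_simps sum.distrib sum_distrib_left
        sum_subtractf)

text \<open>The form is continuous in \<open>v\<close> and the nonnegative half-line is closed in
  the complex plane, so a dense set of vectors decides positivity.\<close>

lemma positive_operator_dense:
  fixes A :: "complex^'m^'m"
  assumes dense: "\<And>X. open X \<Longrightarrow> X \<noteq> {} \<Longrightarrow> \<exists>v\<in>T. v \<in> X"
    and A: "\<And>v. v \<in> T \<Longrightarrow> Im (cinner v (A *v v)) = 0 \<and> 0 \<le> Re (cinner v (A *v v))"
  shows "positive_operator A"
proof -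
  define Q where "Q v = cinner v (A *v v)" for v
  have cont: "continuous_on UNIV Q"
    unfolding Q_def cinner_def matrix_vector_mult_def by (intro continuous_intros)
  have "closed {z. Im z = 0 \<and> 0 \<le> Re z}"
    by (intro closed_Collect_conj closed_Collect_eq closed_Collect_le continuous_on_Im
        continuous_on_Re continuous_on_id continuous_on_const)
  then have "open (- (Q -` {z. Im z = 0 \<and> 0 \<le> Re z}))"
    using cont by (metis closed_vimage open_Compl)
  then have "- (Q -` {z. Im z = 0 \<and> 0 \<le> Re z}) = {}"
    using dense A by (fastforce simp: Q_def)
  then show ?thesis
    by (auto simp: positive_operator_def Q_def complex_is_Real_iff)
qed

text \<open>The reference measure is the outcome distribution in the maximally mixed state. It
  dominates \<open>N\<close> because the norm of a positive operator is controlled by its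
  trace.\<close>

lemma pov_measure_density:
  fixes N :: "'o set \<Rightarrow> complex^'n^'n"
  assumes N: "pov_measure \<Lambda> N"
  defines "p \<equiv> outcome_measure \<Lambda> N (inverse (real CARD('n)) *\<^sub>R mat 1)"
  obtains n where "integrable p n" and "\<And>x. positive_operator (n x)"
    and "\<And>D. D \<in> sets \<Lambda> \<Longrightarrow> (\<integral>x. indicator D x *\<^sub>R n x \<partial>p) = N D"
proof -
  have posI: "positive_operator (inverse (real CARD('n)) *\<^sub>R mat 1 :: complex^'n^'n)"
    by (intro positive_operator_scaleR positive_operator_mat_1) simp
  have Npos: "positive_operator (N D)" if "D \<in> sets \<Lambda>" for D
    using N that by (simp add: pov_measure_def)
  interpret finite_measure p
    by (rule finite_measureI)
      (simp add: p_def emeasure_outcome_measure[OF N posI])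
  have sp: "sets p = sets \<Lambda>" by (simp add: p_def)
  have tr: "real CARD('n) * measure p D = Re (trace (N D))" if "D \<in> sets \<Lambda>" for D
    using measure_outcome_measure[OF N posI that]
    by (simp add: p_def tr_prod_mat_1 tr_prod_scaleR_left)
  have dom: "norm (N D) \<le> (real CARD('n))\<^sup>2 * real CARD('n) * measure p D" if "D \<in> sets p" for D
    using norm_positive_operator[OF Npos, of D] that by (simp add: sp tr mult.assoc)
  obtain f where f: "integrable p f"
    and fD: "\<And>D. D \<in> sets p \<Longrightarrow> (\<integral>x. indicator D x *\<^sub>R f x \<partial>p) = N D"
    using vector_measure_density[of N, OF _ dom] N by (auto simp: pov_measure_def sp)
  have set_integral: "(\<integral>x. indicator D x *\<^sub>R L (f x) \<partial>p) = L (N D)"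
    if L: "linear L" and D: "D \<in> sets p" for L :: "complex^'n^'n \<Rightarrow> real" and D
  proof -
    have bl: "bounded_linear L" using L linear_conv_bounded_linear by blast
    have "(\<integral>x. L (indicator D x *\<^sub>R f x) \<partial>p) = L (N D)"
      using integral_bounded_linear[OF bl integrable_mult_indicator[OF D f]] fD[OF D] by simp
    then show ?thesis using linear_cmul[OF L] by simp
  qed
  have nonneg: "AE x in p. 0 \<le> L (f x)"
    if L: "linear L" and "\<And>D. D \<in> sets p \<Longrightarrow> 0 \<le> L (N D)" for L :: "complex^'n^'n \<Rightarrow> real"
  proof (rule AE_nonneg_of_set_integrals)
    show "integrable p (\<lambda>x. L (f x))"
      using L linear_conv_bounded_linear integrable_bounded_linear[OF _ f] by blast
  qed (simp only: set_integral[OF L] that)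
  have quad: "AE x in p. Im (cinner v (f x *v v)) = 0 \<and> 0 \<le> Re (cinner v (f x *v v))" for v
  proof -
    \<comment> \<open>Vanishing of the imaginary part is obtained as two inequalities, since only
      nonnegativity transfers from set integrals.\<close>
    have "AE x in p. 0 \<le> Re (cinner v (f x *v v))" "AE x in p. 0 \<le> Im (cinner v (f x *v v))"
      "AE x in p. 0 \<le> - Im (cinner v (f x *v v))"
      using Npos
      by (intro nonneg linear_quadratic_form linear_compose_neg;
          simp add: sp positive_operator_def complex_is_Real_iff)+
    then show ?thesis by eventually_elim auto
  qed
  \<comment> \<open>The exceptional null set in \<open>quad\<close> depends on \<open>v\<close>;
    countably many vectors leave a single null set.\<close>
  obtain T :: "(complex^'n) set" where T: "countable T"
    and dense: "\<And>X. open X \<Longrightarrow> X \<noteq> {} \<Longrightarrow> \<exists>v\<in>T. v \<in> X"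
    using countable_dense_setE by blast
  have "AE x in p. \<forall>v\<in>T. Im (cinner v (f x *v v)) = 0 \<and> 0 \<le> Re (cinner v (f x *v v))"
    using T quad by (subst AE_ball_countable) auto
  then have pos: "AE x in p. positive_operator (f x)"
    by eventually_elim (use positive_operator_dense[OF dense] in auto)
  then obtain Z where Z: "Z \<in> null_sets p" and Zpos: "\<And>x. x \<in> space p - Z \<Longrightarrow> positive_operator (f x)"
    by (auto elim: AE_E3)
  \<comment> \<open>Putting 0 on the exceptional set makes the density positive at every point, so
    \<open>G b\<close> below is positive for every \<open>b\<close>.\<close>
  define n where "n x = indicator (space p - Z) x *\<^sub>R f x" for x
  have [measurable]: "f \<in> borel_measurable p" "Z \<in> sets p" using f Z by auto
  have ae: "AE x in p. n x = f x"
    using AE_not_in[OF Z] AE_space by eventually_elim (simp add: n_def)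
  have n[measurable]: "n \<in> borel_measurable p" unfolding n_def by measurable
  show thesis
  proof (rule that)
    show "integrable p n"
      using integrable_cong_AE[OF n _ ae] f by simp
    show "positive_operator (n x)" for x
      using Zpos[of x] by (auto simp: n_def positive_operator_0 split: split_indicator)
    fix D assume "D \<in> sets \<Lambda>"
    then have D[measurable]: "D \<in> sets p" by (simp add: sp)
    have "(\<integral>x. indicator D x *\<^sub>R n x \<partial>p) = (\<integral>x. indicator D x *\<^sub>R f x \<partial>p)"
      using ae by (intro integral_cong_AE) (auto elim!: eventually_mono)
    then show "(\<integral>x. indicator D x *\<^sub>R n x \<partial>p) = N D" by (simp add: fD D)
  qed
qed

subsection \<open>Conditional operators\<close>

text \<open>The partial trace over the second factor of \<open>\<rho>\<close> times \<open>I\<close>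
  tensor \<open>F\<close>: the unnormalised state of the first party when the second party observes
  the effect \<open>F\<close>.\<close>

definition conditional_op ::
    "complex^('m::finite \<times> 'n::finite)^('m \<times> 'n) \<Rightarrow> complex^'n^'n \<Rightarrow> complex^'m^'m" where
  "conditional_op \<rho> F = (\<chi> i j. \<Sum>k\<in>UNIV. \<Sum>l\<in>UNIV. \<rho> $ (i, k) $ (j, l) * F $ l $ k)"

lemma linear_conditional_op: "linear (conditional_op \<rho>)"
  by (rule linearI)
    (simp_all add: conditional_op_def vec_eq_iff algebra_simps sum.distrib scaleR_sum_right)

lemma conditional_op_mat_1: "conditional_op \<rho> (mat 1) = reduced_state1 \<rho>"
  by (simp add: conditional_op_def reduced_state1_def mat_def vec_eq_iff if_distrib cong: if_cong)

lemma sum_UNIV_prod: "(\<Sum>x\<in>UNIV. f x) = (\<Sum>i\<in>UNIV. \<Sum>j\<in>UNIV. f (i, j))"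
  for f :: "'a::finite \<times> 'b::finite \<Rightarrow> 'c::comm_monoid_add"
  by (simp add: UNIV_Times_UNIV[symmetric] sum.cartesian_product del: UNIV_Times_UNIV)

lemma trace_tensor_op:
  "trace (\<rho> ** tensor_op E F) = trace (conditional_op \<rho> F ** E)"
proof -
  have "trace (\<rho> ** tensor_op E F) = (\<Sum>i\<in>UNIV. \<Sum>k\<in>UNIV. \<Sum>j\<in>UNIV. \<Sum>l\<in>UNIV.
      \<rho> $ (i, k) $ (j, l) * (E $ j $ i * F $ l $ k))"
    by (simp add: trace_def matrix_matrix_mult_def tensor_op_def sum_UNIV_prod)
  also have "\<dots> = (\<Sum>i\<in>UNIV. \<Sum>j\<in>UNIV. \<Sum>k\<in>UNIV. \<Sum>l\<in>UNIV.
      \<rho> $ (i, k) $ (j, l) * (E $ j $ i * F $ l $ k))"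
    by (intro sum.cong refl sum.swap)
  also have "\<dots> = trace (conditional_op \<rho> F ** E)"
    by (simp add: trace_def matrix_matrix_mult_def conditional_op_def sum_distrib_right
        sum_distrib_left algebra_simps)
  finally show ?thesis .
qed

text \<open>For fixed \<open>v\<close>, the form \<open>w \<mapsto> \<langle>v \<otimes> w, \<rho> (v \<otimes> w)\<rangle>\<close> is a positive operator on the second
  factor, and pairing it with \<open>F\<close> gives the quadratic form of \<open>conditional_op \<rho> F\<close> at \<open>v\<close>.\<close>

lemma positive_conditional_op:
  assumes \<rho>: "positive_operator \<rho>" and F: "positive_operator F"
  shows "positive_operator (conditional_op \<rho> F)"
proof -
  have "cinner v (conditional_op \<rho> F *v v) \<in> \<real> \<and> 0 \<le> Re (cinner v (conditional_op \<rho> F *v v))" for v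
  proof -
    define B :: "complex^'b^'b" where
      "B = (\<chi> k l. \<Sum>i\<in>UNIV. \<Sum>j\<in>UNIV. cnj (v $ i) * \<rho> $ (i, k) $ (j, l) * v $ j)"
    have "cinner w (B *v w) = cinner (\<chi> x. v $ fst x * w $ snd x) (\<rho> *v (\<chi> x. v $ fst x * w $ snd x))"
      for w
    proof -
      have "cinner w (B *v w) = (\<Sum>k\<in>UNIV. \<Sum>l\<in>UNIV. \<Sum>i\<in>UNIV. \<Sum>j\<in>UNIV.
          cnj (w $ k) * (cnj (v $ i) * \<rho> $ (i, k) $ (j, l) * v $ j * w $ l))"
        by (simp add: B_def cinner_def matrix_vector_mult_def sum_distrib_left sum_distrib_right)
      also have "\<dots> = (\<Sum>k\<in>UNIV. \<Sum>i\<in>UNIV. \<Sum>l\<in>UNIV. \<Sum>j\<in>UNIV.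
          cnj (w $ k) * (cnj (v $ i) * \<rho> $ (i, k) $ (j, l) * v $ j * w $ l))"
        by (intro sum.cong refl sum.swap)
      also have "\<dots> = (\<Sum>i\<in>UNIV. \<Sum>k\<in>UNIV. \<Sum>l\<in>UNIV. \<Sum>j\<in>UNIV.
          cnj (w $ k) * (cnj (v $ i) * \<rho> $ (i, k) $ (j, l) * v $ j * w $ l))"
        by (rule sum.swap)
      also have "\<dots> = (\<Sum>i\<in>UNIV. \<Sum>k\<in>UNIV. \<Sum>j\<in>UNIV. \<Sum>l\<in>UNIV.
          cnj (w $ k) * (cnj (v $ i) * \<rho> $ (i, k) $ (j, l) * v $ j * w $ l))"
        by (intro sum.cong refl sum.swap)
      also have "\<dots> = cinner (\<chi> x. v $ fst x * w $ snd x) (\<rho> *v (\<chi> x. v $ fst x * w $ snd x))"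
        by (simp add: cinner_def matrix_vector_mult_def sum_UNIV_prod sum_distrib_left
            algebra_simps)
      finally show ?thesis .
    qed
    then have B: "positive_operator B"
      using \<rho> by (simp add: positive_operator_def)
    have "cinner v (conditional_op \<rho> F *v v) = (\<Sum>i\<in>UNIV. \<Sum>j\<in>UNIV. \<Sum>k\<in>UNIV. \<Sum>l\<in>UNIV.
        cnj (v $ i) * \<rho> $ (i, k) $ (j, l) * v $ j * F $ l $ k)"
      by (simp add: cinner_def matrix_vector_mult_def conditional_op_def sum_distrib_left
          sum_distrib_right algebra_simps)
    also have "\<dots> = (\<Sum>i\<in>UNIV. \<Sum>k\<in>UNIV. \<Sum>j\<in>UNIV. \<Sum>l\<in>UNIV.
        cnj (v $ i) * \<rho> $ (i, k) $ (j, l) * v $ j * F $ l $ k)"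
      by (intro sum.cong refl sum.swap)
    also have "\<dots> = (\<Sum>k\<in>UNIV. \<Sum>i\<in>UNIV. \<Sum>j\<in>UNIV. \<Sum>l\<in>UNIV.
        cnj (v $ i) * \<rho> $ (i, k) $ (j, l) * v $ j * F $ l $ k)"
      by (rule sum.swap)
    also have "\<dots> = (\<Sum>k\<in>UNIV. \<Sum>i\<in>UNIV. \<Sum>l\<in>UNIV. \<Sum>j\<in>UNIV.
        cnj (v $ i) * \<rho> $ (i, k) $ (j, l) * v $ j * F $ l $ k)"
      by (intro sum.cong refl sum.swap)
    also have "\<dots> = (\<Sum>k\<in>UNIV. \<Sum>l\<in>UNIV. \<Sum>i\<in>UNIV. \<Sum>j\<in>UNIV.
        cnj (v $ i) * \<rho> $ (i, k) $ (j, l) * v $ j * F $ l $ k)"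
      by (intro sum.cong refl sum.swap)
    also have "\<dots> = trace (B ** F)"
      by (simp add: trace_def matrix_matrix_mult_def B_def sum_distrib_right)
    finally show ?thesis
      using trace_mult_nonneg[OF B F] by simp
  qed
  then show ?thesis unfolding positive_operator_def by blast
qed

section \<open>Operator norm bounds and integration over independent outcomes\<close>

lemma linear_matrix_vector_mult: "linear (\<lambda>v. A *v v)"
  for A :: "complex^'m^'m"
  by (rule linearI)
    (simp_all add: matrix_vector_mult_def vec_eq_iff scaleR_sum_right distrib_left sum.distrib)

lemma bounded_linear_matrix_vector_mult: "bounded_linear (\<lambda>v. A *v v)"
  for A :: "complex^'m^'m"
  using linear_matrix_vector_mult linear_conv_bounded_linear by blast

lemma op_norm_nonneg: "0 \<le> op_norm A"
  unfolding op_norm_def by (rule onorm_pos_le[OF bounded_linear_matrix_vector_mult])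

text \<open>By Cauchy-Schwarz the form of \<open>A\<close> at \<open>v\<close> is at most
  \<open>op_norm A\<close> times the squared norm of \<open>v\<close>.\<close>

lemma positive_op_norm_diff:
  fixes A :: "complex^'m^'m"
  assumes A: "positive_operator A" and c: "0 \<le> c" and le: "c * op_norm A \<le> b"
  shows "positive_operator (b *\<^sub>R mat 1 - c *\<^sub>R A)"
  unfolding positive_operator_def
proof (intro allI conjI)
  fix v
  have eq: "cinner v ((b *\<^sub>R mat 1 - c *\<^sub>R A) *v v) =
      of_real b * cinner v v - of_real c * cinner v (A *v v)"
    by (simp add: matrix_vector_mult_diff_rdistrib scaleR_matrix_vector_mult cinner_diff_right
        cinner_scale_right)
  have vv: "cinner v v \<in> \<real>"
    using positive_operator_mat_1 by (metis matrix_vector_mul_lid positive_operator_def)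
  show "cinner v ((b *\<^sub>R mat 1 - c *\<^sub>R A) *v v) \<in> \<real>"
    using A vv unfolding eq positive_operator_def by (intro Reals_diff Reals_mult) auto
  have "c * (v \<bullet> (A *v v)) \<le> c * (norm v * (op_norm A * norm v))"
    using c onorm[OF bounded_linear_matrix_vector_mult, of A v]
    unfolding op_norm_def
    by (intro mult_left_mono order_trans[OF norm_cauchy_schwarz[of v "A *v v"]]) auto
  also have "\<dots> = c * op_norm A * (v \<bullet> v)"
    by (simp add: dot_square_norm power2_eq_square)
  also have "\<dots> \<le> b * (v \<bullet> v)"
    by (intro mult_right_mono le) simp
  finally show "0 \<le> Re (cinner v ((b *\<^sub>R mat 1 - c *\<^sub>R A) *v v))"
    unfolding eq by (simp add: Re_cinner)
qed

text \<open>Serves for hidden values of weight zero, where a conditional state cannot be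
  normalised.\<close>

lemma positive_operator_trace_0:
  fixes A :: "complex^'m^'m"
  assumes "positive_operator A" "Re (trace A) = 0"
  shows "A = 0"
  using norm_positive_operator[OF assms(1)] assms(2) by simp

text \<open>Fubini for independent coordinates: distinct \<open>j\<close> and \<open>k\<close>
  factorise, equal ones leave a single integral.\<close>

lemma PiM_integral_component:
  fixes h :: "'a \<Rightarrow> real"
  assumes I: "finite I" "j \<in> I" "k \<in> I"
    and p: "\<And>i. i \<in> I \<Longrightarrow> prob_space (p i)"
    and D: "D \<in> sets (p j)" and h: "integrable (p k) h"
  shows "integrable (PiM I p) (\<lambda>x. indicator D (x j) * h (x k))"
    and "(\<integral>x. indicator D (x j) * h (x k) \<partial>PiM I p) =
      (if j = k then \<integral>y. indicator D y * h y \<partial>p k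
       else measure (p j) D * (\<integral>y. h y \<partial>p k))"
proof -
  \<comment> \<open>The product locale wants a measure at every index, so a one-point space fills
    the indices outside \<open>I\<close>.\<close>
  define H where "H i = (if i \<in> I then p i else count_space {undefined})" for i
  interpret H: prob_space "H i" for i
    using p by (cases "i \<in> I") (auto simp: H_def intro!: prob_spaceI)
  interpret product_sigma_finite H by unfold_locales
  have P: "PiM I p = PiM I H"
    by (intro PiM_cong) (auto simp: H_def)
  have hH: "integrable (H k) h" and DH: "D \<in> sets (H j)"
    using h D I by (auto simp: H_def)
  define f where "f i = (\<lambda>y. (if i = j then indicator D y else 1) * (if i = k then h y else 1 :: real))"
    for i
  have f: "integrable (H i) (f i)" for i
    using hH DH integrable_real_mult_indicator[OF DH, of h]
    by (cases "i = j"; cases "i = k") (auto simp: f_def mult.commute[of "indicator D _"] less_top[symmetric])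
  have prod: "(\<Prod>i\<in>I. f i (x i)) = indicator D (x j) * h (x k)" for x
    using I by (simp add: f_def prod.distrib)
  show "integrable (PiM I p) (\<lambda>x. indicator D (x j) * h (x k))"
    unfolding P prod[symmetric] by (rule product_integrable_prod[OF I(1) f])
  have "(\<integral>x. indicator D (x j) * h (x k) \<partial>PiM I p) = (\<Prod>i\<in>I. \<integral>y. f i y \<partial>H i)"
    unfolding P prod[symmetric] by (rule product_integral_prod[OF I(1) f])
  \<comment> \<open>For \<open>j = k\<close> the whole integral is assigned to the factor at
    \<open>j\<close>, which keeps the second product equal to 1.\<close>
  also have "\<dots> = (\<Prod>i\<in>I. (if i = j then (if j = k then \<integral>y. indicator D y * h y \<partial>H k else measure (H j) D) else 1)
      * (if i = k \<and> j \<noteq> k then \<integral>y. h y \<partial>H k else 1))"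
    using DH by (intro prod.cong refl) (auto simp: f_def H.prob_space)
  also have "\<dots> = (if j = k then \<integral>y. indicator D y * h y \<partial>H k else measure (H j) D * (\<integral>y. h y \<partial>H k))"
    using I by (cases "j = k") (simp_all add: prod.distrib)
  finally show "(\<integral>x. indicator D (x j) * h (x k) \<partial>PiM I p) =
      (if j = k then \<integral>y. indicator D y * h y \<partial>p k else measure (p j) D * (\<integral>y. h y \<partial>p k))"
    using I by (simp add: H_def)
qed

subsection \<open>The hidden-variable model\<close>

lemma trace_mult_eq_tr_prod:
  "positive_operator A \<Longrightarrow> positive_operator B \<Longrightarrow> trace (A ** B) = complex_of_real (tr_prod A B)"
  by (simp add: tr_prod_def trace_mult_nonneg(1) of_real_Re)

lemma Re_trace_mat_1: "Re (trace (mat 1 :: complex^'m^'m)) = real CARD('m)"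
  by (simp add: trace_def mat_def)

lemma trace_reduced_state1: "trace (reduced_state1 \<rho>) = trace \<rho>"
  by (simp add: trace_def reduced_state1_def sum_UNIV_prod)

lemma conditional_op_noisy_state:
  fixes \<rho> :: "complex^('m::finite \<times> 'n::finite)^('m \<times> 'n)"
  assumes F: "positive_operator F"
  shows "conditional_op (noisy_state \<rho> \<gamma>) F =
    ((1 - \<gamma>) / (real CARD('m) * real CARD('n)) * tr_prod (mat 1) F) *\<^sub>R mat 1 + \<gamma> *\<^sub>R conditional_op \<rho> F"
proof -
  define c where "c = tr_prod (mat 1) F"
  have "trace F = complex_of_real c"
    using trace_mult_eq_tr_prod[OF positive_operator_mat_1 F] by (simp add: c_def)
  then have "conditional_op (mat 1 :: complex^('m \<times> 'n)^('m \<times> 'n)) F = c *\<^sub>R mat 1"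
    by (auto simp: conditional_op_def mat_def vec_eq_iff trace_def if_distrib if_distribR
        scaleR_conv_of_real[where 'a = complex] cong: if_cong)
  moreover have "conditional_op (a *\<^sub>R \<sigma> + \<gamma> *\<^sub>R \<rho>) F = a *\<^sub>R conditional_op \<sigma> F + \<gamma> *\<^sub>R conditional_op \<rho> F"
    for a and \<sigma> :: "complex^('m \<times> 'n)^('m \<times> 'n)"
    by (simp add: conditional_op_def vec_eq_iff algebra_simps sum.distrib scaleR_sum_right)
  ultimately show ?thesis
    by (simp add: noisy_state_def c_def)
qed

text \<open>The value that the hidden-variable integral has to reproduce: white noise gives a
  product of traces, and \<rho> a conditional operator paired with \<open>E\<close>.\<close>

lemma joint_probability_noisy_state:
  fixes \<rho> :: "complex^('m::finite \<times> 'n::finite)^('m \<times> 'n)"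
  assumes \<rho>: "positive_operator \<rho>" and E: "positive_operator E" and F: "positive_operator F"
    and \<gamma>: "0 \<le> \<gamma>" "\<gamma> \<le> 1"
  shows "joint_probability (noisy_state \<rho> \<gamma>) E F = complex_of_real
    ((1 - \<gamma>) / (real CARD('m) * real CARD('n)) * tr_prod (mat 1) F * tr_prod (mat 1) E +
      \<gamma> * tr_prod (conditional_op \<rho> F) E)"
proof -
  have "positive_operator (conditional_op (noisy_state \<rho> \<gamma>) F)"
    unfolding conditional_op_noisy_state[OF F] using \<gamma> F \<rho>
    by (intro positive_operator_add positive_operator_scaleR positive_operator_mat_1
        positive_conditional_op mult_nonneg_nonneg tr_prod_nonneg) auto
  from trace_mult_eq_tr_prod[OF this E] show ?thesis
    by (simp add: joint_probability_def trace_tensor_op conditional_op_noisy_state[OF F]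
        tr_prod_add_left tr_prod_scaleR_left)
qed

lemma has_bochner_integral_tr_prod_conditional_op:
  fixes \<rho> :: "complex^('m::finite \<times> 'n::finite)^('m \<times> 'n)"
  assumes "has_bochner_integral p n F"
  shows "has_bochner_integral p (\<lambda>y. tr_prod (conditional_op \<rho> (n y)) E) (tr_prod (conditional_op \<rho> F) E)"
proof -
  have "linear (\<lambda>X. tr_prod (conditional_op \<rho> X) E)"
    using linear_compose[OF linear_conditional_op linear_tr_prod_left] by (simp add: o_def)
  then have "bounded_linear (\<lambda>X. tr_prod (conditional_op \<rho> X) E)"
    using linear_conv_bounded_linear by blast
  from has_bochner_integral_bounded_linear[OF this assms] show ?thesis .
qed

text \<open>The one-sided case: hidden values are tuples of outcomes of the second party, whose
  response merely reads off its component, while the first party measures the normalised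
  \<open>G b\<close>.\<close>

lemma noisy_state_admits_lhv_model:
  fixes \<rho> :: "complex^('m::finite \<times> 'n::finite)^('m \<times> 'n)"
    and \<Lambda>1 :: "nat \<Rightarrow> 'a measure" and \<Lambda>2 :: "nat \<Rightarrow> 'b measure"
  assumes \<rho>: "density_operator \<rho>" and S2: "S2 \<ge> 1" and \<gamma>0: "0 \<le> \<gamma>"
    and \<gamma>: "\<gamma> * (1 + real CARD('m) * (real S2 - 1) * op_norm (reduced_state1 \<rho>)) \<le> 1"
    and M1: "\<And>s. s \<in> {1..S1} \<Longrightarrow> pov_measure (\<Lambda>1 s) (M1 s)"
    and M2: "\<And>s. s \<in> {1..S2} \<Longrightarrow> pov_measure (\<Lambda>2 s) (M2 s)"
  obtains \<nu> :: "(nat \<Rightarrow> 'b) measure" and P1 P2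
  where "lhv_model S1 S2 (noisy_state \<rho> \<gamma>) \<Lambda>1 M1 \<Lambda>2 M2 \<nu> P1 P2"
proof -
  define I where "I = {1..S2}"
  have I: "finite I" "card I = S2" by (simp_all add: I_def)
  define d1 d2 where "d1 = real CARD('m)" and "d2 = real CARD('n)"
  have d: "d1 > 0" "d2 > 0" by (simp_all add: d1_def d2_def)
  have \<rho>p: "positive_operator \<rho>" and tr\<rho>: "trace \<rho> = 1"
    using \<rho> by (simp_all add: density_operator_def)
  have pos1: "positive_operator (M1 s D)" if "s \<in> {1..S1}" "D \<in> sets (\<Lambda>1 s)" for s D
    using M1 that by (simp add: pov_measure_def)
  have pos2: "positive_operator (M2 s D)" if "s \<in> I" "D \<in> sets (\<Lambda>2 s)" for s D
    using M2 that by (simp add: pov_measure_def I_def)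
  have \<tau>: "positive_operator (reduced_state1 \<rho>)"
    using positive_conditional_op[OF \<rho>p positive_operator_mat_1] by (simp add: conditional_op_mat_1)
  define x where "x = d1 * (real S2 - 1) * op_norm (reduced_state1 \<rho>)"
  have x: "0 \<le> x"
    unfolding x_def using S2 d op_norm_nonneg by (intro mult_nonneg_nonneg) auto
  have \<gamma>x: "\<gamma> + \<gamma> * x \<le> 1" using \<gamma> by (simp add: x_def d1_def algebra_simps)
  then have \<gamma>1: "\<gamma> \<le> 1" using x \<gamma>0 mult_nonneg_nonneg[OF \<gamma>0 x] by linarith
  \<comment> \<open>The part of \<open>G b\<close> independent of \<open>b\<close>: the noise, less
    the surplus reduced states produced by the copies not being looked at. The bound on \<gamma> is
    what makes it positive.\<close>
  define A where "A = ((1 - \<gamma>) / d1) *\<^sub>R mat 1 - (\<gamma> * (real S2 - 1)) *\<^sub>R reduced_state1 \<rho>"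
  have Apos: "positive_operator A"
    unfolding A_def
  proof (rule positive_op_norm_diff[OF \<tau>])
    show "0 \<le> \<gamma> * (real S2 - 1)" using \<gamma>0 S2 by simp
    show "\<gamma> * (real S2 - 1) * op_norm (reduced_state1 \<rho>) \<le> (1 - \<gamma>) / d1"
      using \<gamma>x d by (simp add: x_def field_simps)
  qed
  define p where "p k = outcome_measure (\<Lambda>2 k) (M2 k) (inverse d2 *\<^sub>R mat 1)" for k
  have posI: "positive_operator (inverse d2 *\<^sub>R mat 1 :: complex^'n^'n)"
    using d by (intro positive_operator_scaleR positive_operator_mat_1) simp
  have "Re (trace (inverse d2 *\<^sub>R mat 1 :: complex^'n^'n)) = 1"
    using tr_prod_scaleR_left[of "inverse d2" "mat 1 :: complex^'n^'n" "mat 1"] d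
    by (simp add: tr_prod_mat_1 Re_trace_mat_1 d2_def)
  then have prob: "prob_space (p k)" if "k \<in> I" for k
    unfolding p_def using M2 that posI by (intro prob_space_outcome_measure) (auto simp: I_def)
  have sets_p: "sets (p k) = sets (\<Lambda>2 k)" and space_p: "space (p k) = space (\<Lambda>2 k)" for k
    by (simp_all add: p_def)
  have p: "measure (p k) D = inverse d2 * tr_prod (mat 1) (M2 k D)" if "k \<in> I" "D \<in> sets (\<Lambda>2 k)" for k D
    using measure_outcome_measure[OF M2 posI] that by (simp add: p_def I_def tr_prod_scaleR_left)
  have "\<exists>n. integrable (p k) n \<and> (\<forall>y. positive_operator (n y)) \<and>
      (\<forall>D\<in>sets (\<Lambda>2 k). (\<integral>y. indicator D y *\<^sub>R n y \<partial>p k) = M2 k D)" if "k \<in> I" for k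
  proof -
    have "pov_measure (\<Lambda>2 k) (M2 k)" using M2 that by (simp add: I_def)
    from pov_measure_density[OF this] obtain n where
      "integrable (p k) n" "\<And>y. positive_operator (n y)"
      "\<And>D. D \<in> sets (\<Lambda>2 k) \<Longrightarrow> (\<integral>y. indicator D y *\<^sub>R n y \<partial>p k) = M2 k D"
      unfolding p_def d2_def by blast
    then show ?thesis by blast
  qed
  then obtain n where n_int: "\<And>k. k \<in> I \<Longrightarrow> integrable (p k) (n k)"
    and n_pos: "\<And>k y. k \<in> I \<Longrightarrow> positive_operator (n k y)"
    and n_eq: "\<And>k D. k \<in> I \<Longrightarrow> D \<in> sets (\<Lambda>2 k) \<Longrightarrow> (\<integral>y. indicator D y *\<^sub>R n k y \<partial>p k) = M2 k D"
    by metis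
  have n_hbi: "has_bochner_integral (p k) (\<lambda>y. indicator D y *\<^sub>R n k y) (M2 k D)"
    if "k \<in> I" "D \<in> sets (\<Lambda>2 k)" for k D
    using n_int n_eq that by (auto simp: has_bochner_integral_iff sets_p intro!: integrable_mult_indicator)
  have n_total: "has_bochner_integral (p k) (n k) (mat 1)" if "k \<in> I" for k
  proof -
    have "space (p k) \<in> sets (\<Lambda>2 k)" "M2 k (space (p k)) = mat 1"
      using M2[of k] that sets.top[of "p k"] by (simp_all add: pov_measure_def I_def space_p sets_p)
    then show ?thesis
      using n_hbi[OF that, of "space (p k)"] by (simp cong: has_bochner_integral_cong)
  qed
  define h where "h E k y = tr_prod (conditional_op \<rho> (n k y)) E" for E k y
  have h_total: "has_bochner_integral (p k) (h E k) (tr_prod (reduced_state1 \<rho>) E)" if "k \<in> I" for E k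
    using has_bochner_integral_tr_prod_conditional_op[OF n_total[OF that]]
    by (simp add: h_def[abs_def] conditional_op_mat_1)
  have h_set: "has_bochner_integral (p k) (\<lambda>y. indicator D y * h E k y) (tr_prod (conditional_op \<rho> (M2 k D)) E)"
    if "k \<in> I" "D \<in> sets (\<Lambda>2 k)" for E k D
    using has_bochner_integral_tr_prod_conditional_op[OF n_hbi[OF that], of \<rho> E]
    by (simp add: h_def[abs_def] linear_cmul[OF linear_conditional_op] tr_prod_scaleR_left)

  \<comment> \<open>\<open>\<mu>\<close> is the law of the outcomes when every copy is maximally
    mixed, and \<open>G b\<close> is the operator density, relative to \<open>\<mu>\<close>, of the
    joint measurement on the copies.\<close>
  define \<mu> where "\<mu> = PiM I p"
  define G where "G b = A + \<gamma> *\<^sub>R (\<Sum>k\<in>I. conditional_op \<rho> (n k (b k)))" for b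
  have Gpos: "positive_operator (G b)" for b
    unfolding G_def using \<gamma>0 n_pos \<rho>p
    by (intro positive_operator_add Apos positive_operator_scaleR positive_operator_sum
        positive_conditional_op)
  define g where "g E b = tr_prod (G b) E" for E b
  have g: "g E b = tr_prod A E + \<gamma> * (\<Sum>k\<in>I. h E k (b k))" for E b
    by (simp add: g_def G_def h_def tr_prod_add_left tr_prod_scaleR_left tr_prod_sum_left)
  have g_meas[measurable]: "g E \<in> borel_measurable \<mu>" for E
    unfolding g[abs_def] \<mu>_def using h_total
    by (intro borel_measurable_add borel_measurable_times borel_measurable_sum borel_measurable_const
        measurable_compose[OF measurable_component_singleton]) (auto simp: has_bochner_integral_iff)
  \<comment> \<open>Looking at component \<open>j\<close> only, the summand \<open>k = j\<close>
    yields \<rho>, and each other summand yields the reduced state times the probability of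
    \<open>D\<close>.\<close>
  have key: "has_bochner_integral \<mu> (\<lambda>b. indicator D (b j) * g E b)
      ((1 - \<gamma>) / (d1 * d2) * tr_prod (mat 1) (M2 j D) * tr_prod (mat 1) E
        + \<gamma> * tr_prod (conditional_op \<rho> (M2 j D)) E)"
    if j: "j \<in> I" and D: "D \<in> sets (\<Lambda>2 j)" for j D E
  proof -
    define c t t0 where "c = measure (p j) D" and "t = tr_prod (conditional_op \<rho> (M2 j D)) E"
      and "t0 = tr_prod (reduced_state1 \<rho>) E"
    interpret pj: prob_space "p j" by (rule prob[OF j])
    have 1: "has_bochner_integral \<mu> (\<lambda>b. indicator D (b j) * 1) c"
      using PiM_integral_component[of I j j p D "\<lambda>_. 1"] I j D prob
      by (simp add: has_bochner_integral_iff \<mu>_def sets_p c_def)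
    have 2: "has_bochner_integral \<mu> (\<lambda>b. indicator D (b j) * h E k (b k)) (if j = k then t else c * t0)"
      if k: "k \<in> I" for k
      using PiM_integral_component[of I j k p D "h E k"] I j k D prob h_total[OF k] h_set[OF j D]
      by (auto simp: has_bochner_integral_iff \<mu>_def sets_p c_def t_def t0_def)
    have tr_A: "tr_prod A E = (1 - \<gamma>) / d1 * tr_prod (mat 1) E - \<gamma> * (real S2 - 1) * t0"
      by (simp add: A_def tr_prod_diff_left tr_prod_scaleR_left t0_def)
    have c: "c = inverse d2 * tr_prod (mat 1) (M2 j D)"
      by (simp add: c_def p[OF j D])
    \<comment> \<open>The \<open>S2 - 1\<close> summands with \<open>k\<close> different from
      \<open>j\<close> cancel the reduced state subtracted in \<open>A\<close>; \<open>m\<close>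
      stands for \<open>S2 - 1\<close>.\<close>
    have ring: "(q * e - \<gamma> * m * t0) * c + \<gamma> * (t + m * (c * t0)) = q * e * c + \<gamma> * t" for q e m
      by (simp add: algebra_simps)
    have "(\<Sum>k\<in>I. if j = k then t else c * t0) = t + (real S2 - 1) * (c * t0)"
      using I j S2 by (simp add: sum.remove[of I j] of_nat_diff)
    then have "tr_prod A E * c + \<gamma> * (\<Sum>k\<in>I. if j = k then t else c * t0) =
        (1 - \<gamma>) / d1 * tr_prod (mat 1) E * c + \<gamma> * t"
      by (simp only: tr_A ring)
    also have "\<dots> = (1 - \<gamma>) / (d1 * d2) * tr_prod (mat 1) (M2 j D) * tr_prod (mat 1) E + \<gamma> * t"
      by (simp add: c divide_inverse)
    finally have total: "tr_prod A E * c + \<gamma> * (\<Sum>k\<in>I. if j = k then t else c * t0) = \<dots>" .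
    have "has_bochner_integral \<mu>
        (\<lambda>b. tr_prod A E * (indicator D (b j) * 1) + \<gamma> * (\<Sum>k\<in>I. indicator D (b j) * h E k (b k)))
        (tr_prod A E * c + \<gamma> * (\<Sum>k\<in>I. if j = k then t else c * t0))"
      by (intro has_bochner_integral_add has_bochner_integral_mult_right has_bochner_integral_sum 1 2)
    also have "(\<lambda>b. tr_prod A E * (indicator D (b j) * 1) + \<gamma> * (\<Sum>k\<in>I. indicator D (b j) * h E k (b k))) =
        (\<lambda>b. indicator D (b j) * g E b)"
      by (simp add: g sum_distrib_left[symmetric] distrib_left mult.left_commute mult.commute)
    finally show ?thesis
      unfolding total unfolding t_def .
  qed

  have g0: "0 \<le> g (mat 1) b" for b
    unfolding g_def by (intro tr_prod_nonneg Gpos positive_operator_mat_1)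
  have sp_\<mu>: "b j \<in> space (\<Lambda>2 j)" if "b \<in> space \<mu>" "j \<in> I" for b j
    using that by (auto simp: \<mu>_def space_PiM space_p[symmetric])
  \<comment> \<open>The weight \<open>g (mat 1) b\<close> is the trace of \<open>G b\<close>, the
    probability density of the tuple \<open>b\<close>.\<close>
  define \<nu> where "\<nu> = density \<mu> (\<lambda>b. ennreal (g (mat 1) b))"
  have prob_\<nu>: "prob_space \<nu>"
  proof (rule prob_spaceI)
    \<comment> \<open>Total mass is read off from \<open>key\<close> with the full outcome space of
      any one setting and \<open>E = I\<close>: it is
      \<open>(1 - \<gamma>) + \<gamma>\<close>.\<close>
    have j: "1 \<in> I" using S2 by (simp add: I_def)
    have "has_bochner_integral \<mu> (\<lambda>b. indicator (space (\<Lambda>2 1)) (b 1) * g (mat 1) b) 1"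
      using key[OF j, of "space (\<Lambda>2 1)" "mat 1"] M2[of 1] S2 d
      by (simp add: pov_measure_def conditional_op_mat_1 tr_prod_mat_1 Re_trace_mat_1
          trace_reduced_state1 tr\<rho> d1_def[symmetric] d2_def[symmetric])
    also have "?this \<longleftrightarrow> has_bochner_integral \<mu> (g (mat 1)) 1"
      using sp_\<mu>[OF _ j] by (intro has_bochner_integral_cong) auto
    finally have "has_bochner_integral \<mu> (g (mat 1)) 1" .
    then have "(\<integral>\<^sup>+b. ennreal (g (mat 1) b) \<partial>\<mu>) = 1"
      using g0 by (subst nn_integral_eq_integral) (auto simp: has_bochner_integral_iff)
    then show "emeasure \<nu> (space \<nu>) = 1"
      by (simp add: \<nu>_def emeasure_density cong: nn_integral_cong)
  qed
  \<comment> \<open>At weight zero \<open>inverse\<close> returns 0 and \<open>P1 s b\<close> is the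
    zero measure; such \<open>b\<close> form a null set of \<open>\<nu>\<close>.\<close>
  define P1 where "P1 s b = outcome_measure (\<Lambda>1 s) (M1 s) (inverse (g (mat 1) b) *\<^sub>R G b)" for s b
  have Xpos: "positive_operator (inverse (g (mat 1) b) *\<^sub>R G b)" for b
    using g0[of b] by (intro positive_operator_scaleR Gpos) simp
  have P1: "measure (P1 s b) D = inverse (g (mat 1) b) * g (M1 s D) b"
    if "s \<in> {1..S1}" "D \<in> sets (\<Lambda>1 s)" for s b D
    using measure_outcome_measure[OF M1[OF that(1)] Xpos that(2)]
    by (simp add: P1_def g_def tr_prod_scaleR_left)
  have cd1: "conditional_distribution \<nu> (\<Lambda>1 s) (P1 s)" if s: "s \<in> {1..S1}" for s
    unfolding conditional_distribution_def
  proof (intro conjI ballI)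
    have "prob_space (P1 s b)" if "0 < g (mat 1) b" for b
      unfolding P1_def
    proof (rule prob_space_outcome_measure[OF M1[OF s] Xpos])
      have "Re (trace (inverse (g (mat 1) b) *\<^sub>R G b)) = inverse (g (mat 1) b) * g (mat 1) b"
        unfolding g_def tr_prod_scaleR_left[symmetric] by (simp only: tr_prod_mat_1)
      then show "Re (trace (inverse (g (mat 1) b) *\<^sub>R G b)) = 1"
        using that by simp
    qed
    then show "AE b in \<nu>. prob_space (P1 s b) \<and> sets (P1 s b) = sets (\<Lambda>1 s)"
      unfolding \<nu>_def by (subst AE_density) (auto simp: P1_def)
    show "(\<lambda>b. measure (P1 s b) D) \<in> borel_measurable \<nu>" if "D \<in> sets (\<Lambda>1 s)" for D
      by (simp add: P1[OF s that] \<nu>_def)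
  qed
  have proj: "(\<lambda>b. b s) \<in> \<nu> \<rightarrow>\<^sub>M \<Lambda>2 s" if "s \<in> I" for s
    using measurable_component_singleton[OF that, of p]
    by (simp add: \<nu>_def \<mu>_def measurable_cong_sets[OF refl sets_p])
  have joint: "joint_probability (noisy_state \<rho> \<gamma>) (M1 s1 D1) (M2 s2 D2) = complex_of_real
      (\<integral>b. measure (P1 s1 b) D1 * measure (return (\<Lambda>2 s2) (b s2)) D2 \<partial>\<nu>)"
    if s: "s1 \<in> {1..S1}" "s2 \<in> I" and D: "D1 \<in> sets (\<Lambda>1 s1)" "D2 \<in> sets (\<Lambda>2 s2)"
    for s1 s2 D1 D2
  proof -
    \<comment> \<open>The cancellation holds even at weight zero: a positive \<open>G b\<close> of
      trace 0 vanishes, so both sides are 0.\<close>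
    have g_eq: "g (mat 1) b * (inverse (g (mat 1) b) * g E b) = g E b" for E b
    proof (cases "g (mat 1) b = 0")
      case True
      then have "G b = 0"
        using positive_operator_trace_0[OF Gpos] by (simp add: g_def tr_prod_mat_1)
      then show ?thesis by (simp add: g_def tr_prod_sum)
    qed simp
    have [measurable]: "(\<lambda>b. b s2) \<in> \<mu> \<rightarrow>\<^sub>M \<Lambda>2 s2"
      using proj[OF s(2)] by (simp add: \<nu>_def)
    note [measurable] = D
    have "(\<integral>b. measure (P1 s1 b) D1 * measure (return (\<Lambda>2 s2) (b s2)) D2 \<partial>\<nu>) =
        (\<integral>b. inverse (g (mat 1) b) * g (M1 s1 D1) b * indicator D2 (b s2) \<partial>\<nu>)"
      using s D by (simp add: P1 measure_return)
    also have "\<dots> = (\<integral>b. g (mat 1) b * (inverse (g (mat 1) b) * g (M1 s1 D1) b * indicator D2 (b s2)) \<partial>\<mu>)"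
      unfolding \<nu>_def using g0 by (subst integral_density) auto
    also have "\<dots> = (\<integral>b. indicator D2 (b s2) * g (M1 s1 D1) b \<partial>\<mu>)"
    proof (rule Bochner_Integration.integral_cong[OF refl])
      fix b
      have "g (mat 1) b * (inverse (g (mat 1) b) * g (M1 s1 D1) b * i) = i * g (M1 s1 D1) b" for i
        using g_eq[of b "M1 s1 D1"] by (metis mult.assoc mult.commute)
      then show "g (mat 1) b * (inverse (g (mat 1) b) * g (M1 s1 D1) b * indicator D2 (b s2)) =
          indicator D2 (b s2) * g (M1 s1 D1) b" .
    qed
    also have "\<dots> = (1 - \<gamma>) / (d1 * d2) * tr_prod (mat 1) (M2 s2 D2) * tr_prod (mat 1) (M1 s1 D1)
        + \<gamma> * tr_prod (conditional_op \<rho> (M2 s2 D2)) (M1 s1 D1)"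
      using key[OF s(2) D(2)] by (simp add: has_bochner_integral_iff)
    finally show ?thesis
      using joint_probability_noisy_state[OF \<rho>p pos1[OF s(1) D(1)] pos2[OF s(2) D(2)] \<gamma>0 \<gamma>1]
      by (simp add: d1_def d2_def)
  qed
  have "lhv_model S1 S2 (noisy_state \<rho> \<gamma>) \<Lambda>1 M1 \<Lambda>2 M2 \<nu> P1 (\<lambda>s b. return (\<Lambda>2 s) (b s))"
    unfolding lhv_model_def I_def[symmetric]
    using prob_\<nu> cd1 return_component_conditional_distribution[OF proj] joint by blast
  then show thesis by (rule that)
qed

section \<open>Exchange of the two parties\<close>

definition swap_op ::
    "complex^('m::finite \<times> 'n::finite)^('m \<times> 'n) \<Rightarrow> complex^('n \<times> 'm)^('n \<times> 'm)" where
  "swap_op \<rho> = (\<chi> i j. \<rho> $ prod.swap i $ prod.swap j)"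

lemma sum_UNIV_swap: "(\<Sum>x\<in>UNIV. f (prod.swap x)) = (\<Sum>x\<in>UNIV. f x)"
  for f :: "'a::finite \<times> 'b::finite \<Rightarrow> 'c::comm_monoid_add"
  by (rule sum.reindex_bij_witness[of _ prod.swap prod.swap]) auto

lemma reduced_state1_swap_op: "reduced_state1 (swap_op \<rho>) = reduced_state2 \<rho>"
  by (simp add: reduced_state1_def reduced_state2_def swap_op_def)

lemma density_operator_swap_op:
  assumes "density_operator \<rho>"
  shows "density_operator (swap_op \<rho>)"
proof -
  have "cinner v (swap_op \<rho> *v v) = cinner (\<chi> x. v $ prod.swap x) (\<rho> *v (\<chi> x. v $ prod.swap x))" for v
  proof -
    have "cinner v (swap_op \<rho> *v v) = (\<Sum>x\<in>UNIV. \<Sum>y\<in>UNIV.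
        cnj (v $ prod.swap (prod.swap x)) * (\<rho> $ prod.swap x $ prod.swap y * v $ prod.swap (prod.swap y)))"
      by (simp add: cinner_def matrix_vector_mult_def swap_op_def sum_distrib_left)
    also have "\<dots> = (\<Sum>x\<in>UNIV. \<Sum>y\<in>UNIV.
        cnj (v $ prod.swap (prod.swap x)) * (\<rho> $ prod.swap x $ y * v $ prod.swap y))"
      by (intro sum.cong refl sum_UNIV_swap)
    also have "\<dots> = (\<Sum>x\<in>UNIV. \<Sum>y\<in>UNIV. cnj (v $ prod.swap x) * (\<rho> $ x $ y * v $ prod.swap y))"
      by (rule sum_UNIV_swap)
    also have "\<dots> = cinner (\<chi> x. v $ prod.swap x) (\<rho> *v (\<chi> x. v $ prod.swap x))"
      by (simp add: cinner_def matrix_vector_mult_def sum_distrib_left)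
    finally show ?thesis .
  qed
  moreover have "trace (swap_op \<rho>) = trace \<rho>"
    unfolding trace_def swap_op_def by (simp add: sum_UNIV_swap[of "\<lambda>x. \<rho> $ x $ x"])
  ultimately show ?thesis
    using assms by (simp add: density_operator_def positive_operator_def)
qed

lemma noisy_state_swap_op: "noisy_state (swap_op \<rho>) \<gamma> = swap_op (noisy_state \<rho> \<gamma>)"
  by (simp add: noisy_state_def swap_op_def vec_eq_iff mat_def mult.commute)

lemma joint_probability_swap_op: "joint_probability (swap_op \<rho>) F E = joint_probability \<rho> E F"
proof -
  have "joint_probability (swap_op \<rho>) F E = (\<Sum>x\<in>UNIV. \<Sum>y\<in>UNIV.
      \<rho> $ prod.swap x $ prod.swap y * tensor_op E F $ prod.swap y $ prod.swap x)"
    by (simp add: joint_probability_def trace_def matrix_matrix_mult_def swap_op_def tensor_op_def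
        mult.commute)
  also have "\<dots> = (\<Sum>x\<in>UNIV. \<Sum>y\<in>UNIV. \<rho> $ prod.swap x $ y * tensor_op E F $ y $ prod.swap x)"
    by (intro sum.cong refl sum_UNIV_swap)
  also have "\<dots> = (\<Sum>x\<in>UNIV. \<Sum>y\<in>UNIV. \<rho> $ x $ y * tensor_op E F $ y $ x)"
    by (rule sum_UNIV_swap)
  also have "\<dots> = joint_probability \<rho> E F"
    by (simp add: joint_probability_def trace_def matrix_matrix_mult_def)
  finally show ?thesis .
qed

text \<open>The hidden space and responses carry over unchanged, since the joint probabilities agree
  and the product under the integral commutes.\<close>

lemma lhv_model_swap_op:
  "lhv_model S2 S1 (swap_op \<rho>) \<Lambda>2 M2 \<Lambda>1 M1 \<nu> P2 P1 \<Longrightarrow> lhv_model S1 S2 \<rho> \<Lambda>1 M1 \<Lambda>2 M2 \<nu> P1 P2"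
  unfolding lhv_model_def joint_probability_swap_op by (auto simp: mult.commute)

theorem proposition6:
  fixes \<rho> :: "complex^('m::finite \<times> 'n::finite)^('m \<times> 'n)"
    and S1 S2 :: nat and \<gamma> :: real
  assumes "CARD('m) \<ge> 2" and "CARD('n) \<ge> 2"
    and "S1 \<ge> 1" and "S2 \<ge> 1" and "S1 + S2 > 2"
    and "density_operator \<rho>"
    and "\<not> admits_lhv_description TYPE('p) TYPE('q) S1 S2 \<rho>"
    and "0 \<le> \<gamma>" and "\<gamma> \<le> inverse (1 + beta S1 S2 \<rho>)"
  shows "admits_lhv_description TYPE('a) TYPE('b) S1 S2 (noisy_state \<rho> \<gamma>)"
  unfolding admits_lhv_description_def
proof (intro allI impI)
  fix \<Lambda>1 :: "nat \<Rightarrow> 'a measure" and M1 and \<Lambda>2 :: "nat \<Rightarrow> 'b measure" and M2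
  assume M1: "\<forall>s\<in>{1..S1}. pov_measure (\<Lambda>1 s) (M1 s :: _ \<Rightarrow> complex^'m^'m)"
    and M2: "\<forall>s\<in>{1..S2}. pov_measure (\<Lambda>2 s) (M2 s :: _ \<Rightarrow> complex^'n^'n)"
  define b1 where "b1 = real CARD('m) * (real S2 - 1) * op_norm (reduced_state1 \<rho>)"
  define b2 where "b2 = real CARD('n) * (real S1 - 1) * op_norm (reduced_state2 \<rho>)"
  have beta: "beta S1 S2 \<rho> = min b1 b2"
    by (simp add: beta_def b1_def b2_def)
  have b: "0 \<le> b1" "0 \<le> b2"
    unfolding b1_def b2_def using assms(3,4) op_norm_nonneg by (auto intro!: mult_nonneg_nonneg)
  have "\<gamma> * (1 + min b1 b2) \<le> inverse (1 + min b1 b2) * (1 + min b1 b2)"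
    using assms(9) b unfolding beta by (intro mult_right_mono) auto
  also have "\<dots> = 1"
    using b by (intro left_inverse) (auto simp: min_def)
  \<comment> \<open>The minimum equals one of its arguments, which selects the party whose outcome
    tuples become the hidden variable.\<close>
  finally have "\<gamma> * (1 + b1) \<le> 1 \<or> \<gamma> * (1 + b2) \<le> 1"
    by (auto simp: min_def split: if_splits)
  then show "admits_lhv_model S1 S2 (noisy_state \<rho> \<gamma>) \<Lambda>1 M1 \<Lambda>2 M2"
  proof
    assume "\<gamma> * (1 + b1) \<le> 1"
    then obtain \<nu> P1 P2 where "lhv_model S1 S2 (noisy_state \<rho> \<gamma>) \<Lambda>1 M1 \<Lambda>2 M2 (\<nu> :: (nat \<Rightarrow> 'b) measure) P1 P2"
      using noisy_state_admits_lhv_model[OF assms(6,4,8), of S1 \<Lambda>1 M1 \<Lambda>2 M2] M1 M2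
      unfolding b1_def by metis
    \<comment> \<open>Moves the model from outcome tuples of the second party to the pairs of tuples
      demanded by \<open>admits_lhv_model\<close>.\<close>
    then show ?thesis by (rule admits_lhv_modelI)
  next
    \<comment> \<open>With the parties exchanged, the reduced state on the second factor takes the
      place of the first, so the one-sided case applies to \<open>swap_op \<rho>\<close>.\<close>
    assume "\<gamma> * (1 + b2) \<le> 1"
    then obtain \<nu> P1 P2 where
      "lhv_model S2 S1 (swap_op (noisy_state \<rho> \<gamma>)) \<Lambda>2 M2 \<Lambda>1 M1 (\<nu> :: (nat \<Rightarrow> 'a) measure) P1 P2"
      using noisy_state_admits_lhv_model[OF density_operator_swap_op[OF assms(6)] assms(3,8),
          of S2 \<Lambda>2 M2 \<Lambda>1 M1] M1 M2
      unfolding b2_def reduced_state1_swap_op noisy_state_swap_op by metis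
    then show ?thesis by (rule admits_lhv_modelI[OF lhv_model_swap_op])
  qed
qed

end
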